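(* Let $F(z)=\sum_{k=0}^{n}A_kz^{n-k}\in\mathbb C[z]^{p\times p}$ be monic ($A_0=I_p$) of degree $n=2m$ or $n=2m+1$. Let $\mathscr S$ be the sequence of right Markov parameters of $F$ (for $n=2m$), resp. of right Markov parameters of first type of $F$ (for $n=2m+1$, when the even part $F_e$ is regular), and assume all its terms are Hermitian matrices. Let $H=[\mathbf s_{j+k}]_{j,k=0}^{\infty}$. Then $F$ is a Hurwitz matrix polynomial if and only if all of the following hold: (i) all contiguous block-Hankel quasiminors of $H$ of order $\le m$ are (well defined and) positive definite; (ii) all block-Hankel minors of $H$ of order $>m$ are equal to $0$; (iii) if $n=2m+1$, then $\mathbf s_{-1}\succ0$.
   Context: Even/odd parts: if $n=2m$, $F_e(z)=\sum_{k=0}^mA_{2k}z^{m-k}$, $F_o(z)=\sum_{k=1}^mA_{2k-1}z^{m-k}$; if $n=2m+1$, $F_e(z)=\sum_{k=0}^mA_{2k+1}z^{m-k}$, $F_o(z)=\sum_{k=0}^mA_{2k}z^{m-k}$. Right Markov parameters ($n=2m$): $F_o(z)F_e(z)^{-1}=\sum_{k\ge0}(-1)^kz^{-(k+1)}\mathbf s_k$ for large $|z|$. Right Markov parameters of first type ($n=2m+1$, $\det F_e\not\equiv0$): $F_o(z)F_e(z)^{-1}=\mathbf s_{-1}+\sum_{k\ge0}(-1)^kz^{-(k+1)}\mathbf s_k$ for large $|z|$. For $l\ge1$, integers $0\le j_1<\dots<j_l$, $0\le k_1<\dots<k_l$, let $\widetilde H_l=[\mathbf s_{j_a+k_b}]_{a,b=1}^{l}\in\mathbb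 C^{lp\times lp}$; $\det\widetilde H_l$ is a block-Hankel minor of order $l$ of $H$. The quasideterminant $|\widetilde H_l|_{ll}$ is the Schur complement $M_{ll}-[M_{l1},\dots,M_{l,l-1}]\,([M_{ab}]_{a,b=1}^{l-1})^{-1}[M_{1l};\dots;M_{l-1,l}]$ where $M_{ab}=\mathbf s_{j_a+k_b}$, defined when $[M_{ab}]_{a,b=1}^{l-1}$ is nonsingular (for $l=1$ it is $M_{11}$); it is a block-Hankel quasiminor of order $l$. Minors/quasiminors are contiguous if $j_{a+1}-j_a=1$ and $k_{b+1}-k_b=1$ for all $a,b$. Hurwitz matrix polynomial: all roots of $\det F(z)$ lie in $\operatorname{Re}z<0$. *)

theory Defs
  imports Complex_Main "Jordan_Normal_Form.Determinant"
begin

(* Matrices are Jordan_Normal_Form matrices ('a mat) with explicit dimensions.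
   A matrix polynomial F(z) = sum_{k=0}^n A_k z^(n-k) is given by its coefficient
   sequence A :: nat => complex mat (A k is p x p for k <= n). *)

definition minv :: "complex mat \<Rightarrow> complex mat" where
  "minv M = (1 / det M) \<cdot>\<^sub>m adj_mat M"

definition hermitian_mat :: "complex mat \<Rightarrow> bool" where
  "hermitian_mat M \<longleftrightarrow> dim_row M = dim_col M \<and>
     (\<forall>i < dim_row M. \<forall>j < dim_row M. M $$ (i, j) = cnj (M $$ (j, i)))"

definition pos_def_mat :: "complex mat \<Rightarrow> bool" where
  "pos_def_mat M \<longleftrightarrow> hermitian_mat M \<and>
     (\<forall>v. v \<in> carrier_vec (dim_row M) \<and> v \<noteq> 0\<^sub>v (dim_row M) \<longrightarrow>
        Re (\<Sum>i < dim_row M. cnj (v $ i) * (M *\<^sub>v v) $ i) > 0)"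

definition mpoly_eval :: "nat \<Rightarrow> nat \<Rightarrow> (nat \<Rightarrow> complex mat) \<Rightarrow> complex \<Rightarrow> complex mat" where
  "mpoly_eval p n A z = mat p p (\<lambda>(i, j). \<Sum>k\<le>n. z ^ (n - k) * A k $$ (i, j))"

definition even_part :: "nat \<Rightarrow> nat \<Rightarrow> (nat \<Rightarrow> complex mat) \<Rightarrow> complex \<Rightarrow> complex mat" where
  "even_part p n A z = (let m = n div 2 in
     if even n then mat p p (\<lambda>(i, j). \<Sum>k\<le>m. A (2 * k) $$ (i, j) * z ^ (m - k))
     else mat p p (\<lambda>(i, j). \<Sum>k\<le>m. A (2 * k + 1) $$ (i, j) * z ^ (m - k)))"

definition odd_part :: "nat \<Rightarrow> nat \<Rightarrow> (nat \<Rightarrow> complex mat) \<Rightarrow> complex \<Rightarrow> complex mat" where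
  "odd_part p n A z = (let m = n div 2 in
     if even n then mat p p (\<lambda>(i, j). \<Sum>k\<in>{1..m}. A (2 * k - 1) $$ (i, j) * z ^ (m - k))
     else mat p p (\<lambda>(i, j). \<Sum>k\<le>m. A (2 * k) $$ (i, j) * z ^ (m - k)))"

text \<open>s is the sequence of right Markov parameters (n even; then s_{-1} := 0 is
  passed as c) resp. (s_{-1} = c, s) are the right Markov parameters of first
  type (n odd, det F_e not identically 0):
  F_o(z) F_e(z)^{-1} = c + sum_k (-1)^k z^{-(k+1)} s_k for all large |z|.\<close>
definition markov_params ::
  "nat \<Rightarrow> nat \<Rightarrow> (nat \<Rightarrow> complex mat) \<Rightarrow> complex mat \<Rightarrow> (nat \<Rightarrow> complex mat) \<Rightarrow> bool" where
  "markov_params p n A c s \<longleftrightarrow>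
     c \<in> carrier_mat p p \<and> (\<forall>k. s k \<in> carrier_mat p p) \<and>
     (\<exists>R. \<forall>z. R < norm z \<longrightarrow> det (even_part p n A z) \<noteq> 0 \<and>
        (\<forall>i < p. \<forall>j < p.
          (\<lambda>k. (-1) ^ k / z ^ (k + 1) * s k $$ (i, j)) sums
            ((odd_part p n A z * minv (even_part p n A z)) $$ (i, j) - c $$ (i, j))))"

definition hurwitz_mpoly :: "nat \<Rightarrow> nat \<Rightarrow> (nat \<Rightarrow> complex mat) \<Rightarrow> bool" where
  "hurwitz_mpoly p n A \<longleftrightarrow> (\<forall>z. det (mpoly_eval p n A z) = 0 \<longrightarrow> Re z < 0)"

definition block_hankel :: "nat \<Rightarrow> (nat \<Rightarrow> complex mat) \<Rightarrow> nat \<Rightarrow> (nat \<Rightarrow> nat) \<Rightarrow> (nat \<Rightarrow> nat) \<Rightarrow> complex mat" where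
  "block_hankel p s l js ks =
     mat (l * p) (l * p) (\<lambda>(r, c). s (js (r div p) + ks (c div p)) $$ (r mod p, c mod p))"

definition bh_lead :: "nat \<Rightarrow> nat \<Rightarrow> complex mat \<Rightarrow> complex mat" where
  "bh_lead p l M = mat ((l - 1) * p) ((l - 1) * p) (\<lambda>(r, c). M $$ (r, c))"

definition quasiminor :: "nat \<Rightarrow> nat \<Rightarrow> complex mat \<Rightarrow> complex mat" where
  "quasiminor p l M = (let q = (l - 1) * p;
      B = mat q p (\<lambda>(r, c). M $$ (r, q + c));
      C = mat p q (\<lambda>(r, c). M $$ (q + r, c));
      D = mat p p (\<lambda>(r, c). M $$ (q + r, q + c))
    in D - C * minv (bh_lead p l M) * B)"

definition strict_inc_upto :: "nat \<Rightarrow> (nat \<Rightarrow> nat) \<Rightarrow> bool" where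
  "strict_inc_upto l f \<longleftrightarrow> (\<forall>a. a + 1 < l \<longrightarrow> f a < f (a + 1))"

end

theory Submission
  imports Defs "HOL-Computational_Algebra.Fundamental_Theorem_Algebra"
begin

text \<open>Write \<open>F(z) = E(z\<^sup>2) + z O(z\<^sup>2)\<close>. On the space of sequences \<open>y\<close> with \<open>F(shift) y = 0\<close>, the Hankel
  forms of \<open>(s\<^sub>k)\<close> and \<open>(s\<^sub>k\<^sub>+\<^sub>1)\<close>, evaluated on the Bezoutian states
  \<open>((E(X) - E(W)) / (X - W)) y\<close> and \<open>((E(X) - E(W)) / (X - W)) shift(y)\<close> with \<open>X = shift\<^sup>2\<close>, together with
  \<open>(E y)\<^sup>* s\<^sub>-\<^sub>1 (E y)\<close> in odd degree, add up to an energy whose derivative along the shift is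
  \<open>-2 |E y|\<^sup>2\<close>. If \<open>F\<close> is Hurwitz, Lyapunov's argument makes the energy positive definite;
  the states are arbitrary, so all the forms are positive definite. Conversely, positivity applied to
  \<open>y\<^sub>k = z\<^sup>k u\<close> with \<open>F(z) u = 0\<close> forces \<open>Re z < 0\<close>. The forms with larger shifts follow because
  multiplication by \<open>W\<close> is selfadjoint, and quasiminors are the successive Schur complements.\<close>

section \<open>Polynomials in the shift\<close>

text \<open>A sequence \<open>y\<close> plays the role of the derivatives at 0 of a solution of the
  differential equation F(d/dt) y = 0, so the shift is differentiation and the product rule explains
  the word derivative. Such a sequence need not tend to 0 when F is Hurwitz, so no limit or integral
  along it is available; Lyapunov's inequality is proved algebraically instead, on the polynomials
  in the shift applied to one trajectory. The shape of the energy comes from a dimension count.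
  Trajectories form a space of dimension n p. The two states contribute m p coordinates each, and in
  odd degree the vector E y contributes p more, which makes n p independent coordinates. In them the
  energy is block diagonal, with the Hankel matrices of s_k and s_{k+1} and with s_{-1} as blocks,
  so it is positive definite exactly if each block is. The vanishing of the larger minors is a
  matter of rank: the recurrence with characteristic polynomial E expresses every block column of H
  through the first m.\<close>

text \<open>The indeterminate acts on sequences as the left shift.\<close>

definition pact :: "'a::comm_ring_1 poly \<Rightarrow> (nat \<Rightarrow> 'a) \<Rightarrow> nat \<Rightarrow> 'a" where
  "pact f x k = (\<Sum>i\<le>degree f. coeff f i * x (i + k))"

lemma pact_bound:
  assumes "degree f \<le> N"
  shows "pact f x k = (\<Sum>i\<le>N. coeff f i * x (i + k))"
  unfolding pact_def
  by (rule sum.mono_neutral_left) (use assms in \<open>auto simp: coeff_eq_0\<close>)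

lemma pact_0 [simp]: "pact 0 x k = 0"
  by (simp add: pact_def)

lemma pact_pCons: "pact (pCons c f) x k = c * x k + pact f x (Suc k)"
proof -
  have "pact (pCons c f) x k = (\<Sum>i\<le>Suc (degree f). coeff (pCons c f) i * x (i + k))"
    by (rule pact_bound) (simp add: degree_pCons_le)
  also have "\<dots> = c * x k + (\<Sum>i\<le>degree f. coeff f i * x (i + Suc k))"
    by (subst sum.atMost_Suc_shift) simp
  finally show ?thesis by (simp add: pact_def)
qed

lemma pact_add: "pact (f + g) x k = pact f x k + pact g x k"
proof -
  let ?N = "max (degree f) (degree g)"
  have "degree (f + g) \<le> ?N" by (rule degree_add_le_max)
  then show ?thesis
    by (simp add: pact_bound[of _ ?N] sum.distrib algebra_simps)
qed

lemma pact_smult: "pact (smult c f) x k = c * pact f x k"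
  using degree_smult_le[of c f]
  by (simp add: pact_bound[of _ "degree f"] sum_distrib_left mult.assoc)

lemma pact_minus: "pact (- f) x k = - pact f x k"
  by (simp add: pact_def sum_negf)

lemma pact_diff: "pact (f - g) x k = pact f x k - pact g x k"
  using pact_add[of f "- g" x k] by (simp add: pact_minus)

lemma pact_sum: "pact (\<Sum>i\<in>I. f i) x k = (\<Sum>i\<in>I. pact (f i) x k)"
  by (induction I rule: infinite_finite_induct) (auto simp: pact_add)

lemma pact_mult: "pact (f * g) x k = pact f (pact g x) k"
proof (induction f arbitrary: k)
  case (pCons c f)
  then show ?case by (simp add: pact_add pact_smult pact_pCons)
qed simp

lemma pact_shift: "pact f (\<lambda>i. x (i + j)) k = pact f x (k + j)"
  by (simp add: pact_def add.assoc)

lemma pact_const: "pact [:c:] x k = c * x k"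
  by (simp add: pact_pCons)

lemma pact_1 [simp]: "pact 1 x k = x k"
  by (simp add: one_pCons pact_const)

lemma pact_add_seq: "pact f (\<lambda>i. x i + y i) k = pact f x k + pact f y k"
  by (simp add: pact_def algebra_simps sum.distrib)

lemma pact_cmult_seq: "pact f (\<lambda>i. c * x i) k = c * pact f x k"
  by (simp add: pact_def algebra_simps sum_distrib_left)

lemma pact_zero_seq [simp]: "pact f (\<lambda>i. 0) k = 0"
  by (simp add: pact_def)

lemma pact_sum_seq: "pact f (\<lambda>i. \<Sum>j\<in>J. x j i) k = (\<Sum>j\<in>J. pact f (x j) k)"
  by (induction J rule: infinite_finite_induct) (auto simp: pact_add_seq)

lemma pact_commute: "pact f (pact g x) k = pact g (pact f x) k"
  by (metis pact_mult mult.commute)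

lemma pact_subst_square: "pact (pcompose f [:0, 0, 1:]) x k = pact f (\<lambda>i. x (2 * i + k)) 0"
proof (induction f arbitrary: k)
  case (pCons c f)
  have "pact f (\<lambda>i. x (2 * i + k)) (Suc 0) = pact f (\<lambda>i. x (2 * (i + 1) + k)) 0"
    by (subst pact_shift) simp
  with pCons show ?case
    by (simp add: pcompose_pCons pact_add pact_pCons)
qed simp

lemma pact_geometric: "pact f (\<lambda>i. z ^ i * u) k = poly f z * z ^ k * u"
  by (induction f arbitrary: k) (auto simp: pact_pCons algebra_simps)

text \<open>The divided difference \<open>(e(X) - e(W)) / (X - W)\<close>, as a polynomial in \<open>W\<close>, with \<open>X\<^sup>k\<close>
  replaced by \<open>x k\<close>.\<close>

definition dquot :: "'a::comm_ring_1 poly \<Rightarrow> (nat \<Rightarrow> 'a) \<Rightarrow> 'a poly" where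
  "dquot e x = (\<Sum>i<degree e. monom (pact (poly_shift (Suc i) e) x 0) i)"

lemma coeff_dquot: "coeff (dquot e x) i = pact (poly_shift (Suc i) e) x 0"
proof (cases "i < degree e")
  case True
  then show ?thesis by (simp add: dquot_def coeff_sum coeff_monom)
next
  case False
  then have "poly_shift (Suc i) e = 0"
    by (intro poly_eqI) (simp add: coeff_poly_shift coeff_eq_0)
  with False show ?thesis by (simp add: dquot_def coeff_sum coeff_monom)
qed

lemma coeff_dquot_sum:
  assumes "degree e \<le> N"
  shows "coeff (dquot e x) i = (\<Sum>j\<in>{i<..N}. coeff e j * x (j - 1 - i))"
proof -
  have "degree (poly_shift (Suc i) e) \<le> N"
    by (rule degree_le) (use assms in \<open>auto simp: coeff_poly_shift coeff_eq_0\<close>)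
  then have "coeff (dquot e x) i = (\<Sum>k\<le>N. coeff e (k + Suc i) * x k)"
    by (simp add: coeff_dquot pact_bound coeff_poly_shift)
  also have "\<dots> = (\<Sum>k\<in>{k. k + Suc i \<le> N}. coeff e (k + Suc i) * x k)"
    by (rule sum.mono_neutral_right) (use assms in \<open>auto simp: coeff_eq_0\<close>)
  also have "\<dots> = (\<Sum>j\<in>{i<..N}. coeff e j * x (j - 1 - i))"
    by (rule sum.reindex_bij_witness[of _ "\<lambda>j. j - Suc i" "\<lambda>k. k + Suc i"]) auto
  finally show ?thesis .
qed

lemma coeff_dquot_eq_0: "degree e \<le> i \<Longrightarrow> coeff (dquot e x) i = 0"
  by (simp add: coeff_dquot_sum[OF order.refl])

lemma dquot_0 [simp]: "dquot 0 x = 0"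
  by (simp add: dquot_def)

lemma dquot_pCons: "dquot (pCons c e) x = pCons (pact e x 0) (dquot e x)"
proof (rule poly_eqI)
  fix i
  have *: "poly_shift (Suc i) (pCons c e) = poly_shift i e" for i
    by (rule poly_eqI) (simp add: coeff_poly_shift)
  have "poly_shift 0 e = e"
    by (rule poly_eqI) (simp add: coeff_poly_shift)
  then show "coeff (dquot (pCons c e) x) i = coeff (pCons (pact e x 0) (dquot e x)) i"
    by (cases i) (simp_all add: coeff_dquot *)
qed

lemma dquot_add_seq: "dquot e (\<lambda>i. x i + y i) = dquot e x + dquot e y"
  by (rule poly_eqI) (simp add: coeff_dquot pact_add_seq)

lemma dquot_cmult_seq: "dquot e (\<lambda>i. c * x i) = smult c (dquot e x)"
  by (rule poly_eqI) (simp add: coeff_dquot pact_cmult_seq)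

lemma dquot_zero_seq [simp]: "dquot e (\<lambda>i. 0) = 0"
  by (rule poly_eqI) (simp add: coeff_dquot)

text \<open>From X = W + (X - W): multiplying (e(X) - e(W)) / (X - W) by X gives W times the
  quotient plus e(X) - e(W).\<close>

lemma dquot_shift:
  "dquot e (\<lambda>i. x (Suc i)) = pCons 0 (dquot e x) + [:pact e x 0:] - smult (x 0) e"
proof (induction e)
  case (pCons c e)
  have "pact e (\<lambda>i. x (Suc i)) 0 = pact e x (Suc 0)"
    using pact_shift[of e x 1 0] by simp
  with pCons show ?case by (simp add: dquot_pCons pact_pCons)
qed simp

text \<open>The divided difference is symmetric in X and W; \<open>x\<close> evaluates the powers of
  one and \<open>y\<close> those of the other.\<close>

lemma pact_dquot_commute: "pact (dquot e x) y 0 = pact (dquot e y) x 0"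
proof (induction e arbitrary: x)
  case (pCons c e)
  have "pact (dquot (pCons c e) x) y 0 = pact (pCons 0 (dquot e x) + [:pact e x 0:]) y 0"
    by (simp add: dquot_pCons)
  also have "pCons 0 (dquot e x) + [:pact e x 0:] = dquot e (\<lambda>i. x (Suc i)) + smult (x 0) e"
    by (simp add: dquot_shift)
  also have "pact \<dots> y 0 = pact (dquot e y) (\<lambda>i. x (Suc i)) 0 + x 0 * pact e y 0"
    by (simp add: pact_add pact_smult pCons.IH)
  also have "\<dots> = pact (dquot (pCons c e) y) x 0"
    using pact_shift[of "dquot e y" x 1 0] by (simp add: dquot_pCons pact_pCons)
  finally show ?case .
qed simp

text \<open>A vector on which a semidefinite form vanishes is orthogonal to everything: \<open>\<gamma> + 2 Re (t \<beta>)\<close>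
  is the expansion of \<open>\<phi> (t x + y) (t x + y)\<close> with \<open>\<phi> x x = 0\<close>.\<close>

lemma hermitian_null_vector:
  fixes \<gamma> :: real and \<beta> :: complex
  assumes "\<And>t. 0 \<le> \<gamma> + 2 * Re (t * \<beta>)"
  shows "\<beta> = 0"
proof (rule ccontr)
  assume "\<beta> \<noteq> 0"
  let ?N = "(\<bar>\<gamma>\<bar> + 1) / (cmod \<beta>)\<^sup>2"
  have "- of_real ?N * cnj \<beta> * \<beta> = of_real (- ?N * (cmod \<beta>)\<^sup>2)"
    using complex_norm_square[of \<beta>] by (simp add: mult.commute)
  then have "Re (- of_real ?N * cnj \<beta> * \<beta>) = - ?N * (cmod \<beta>)\<^sup>2"
    by (simp only: Re_complex_of_real)
  also have "\<dots> = - (\<bar>\<gamma>\<bar> + 1)" using \<open>\<beta> \<noteq> 0\<close> by simp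
  finally show False using assms[of "- of_real ?N * cnj \<beta>"] by linarith
qed

section \<open>A scalar Lyapunov theorem\<close>

text \<open>Induction on the roots: the cofactor \<open>d\<close> of \<open>X - r\<close> is an eigenvector of multiplication by \<open>X\<close>
  modulo the annihilator, so either \<open>d\<close> lies in the radical of \<open>\<phi>\<close> or \<open>\<phi> d d > 0\<close>, and then \<open>d\<close>
  is split off orthogonally.\<close>

lemma pos_form_of_left_roots:
  fixes \<phi> :: "complex poly \<Rightarrow> complex poly \<Rightarrow> complex"
  assumes add: "\<And>a b c. \<phi> a (b + c) = \<phi> a b + \<phi> a c"
    and smult: "\<And>a b c. \<phi> a (smult c b) = c * \<phi> a b"
    and herm: "\<And>a b. \<phi> b a = cnj (\<phi> a b)"
    and diss: "\<And>a. Re (\<phi> a (pCons 0 a)) \<le> 0"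
    and left: "\<And>r. r \<in> set rs \<Longrightarrow> Re r < 0"
    and null: "\<And>a b. \<phi> a ((\<Prod>r\<leftarrow>rs. [:- r, 1:]) * b) = 0"
  shows "0 \<le> Re (\<phi> a a)"
  using assms
proof (induction rs arbitrary: \<phi> a)
  case Nil
  show ?case using Nil.prems(6)[of a a] by simp
next
  case (Cons r rs)
  note add = Cons.prems(1) and smult = Cons.prems(2) and herm = Cons.prems(3)
    and diss = Cons.prems(4)
  define d where "d = (\<Prod>r\<leftarrow>rs. [:- r, 1:])"
  have null: "\<phi> a ([:- r, 1:] * d * b) = 0" for a b
    using Cons.prems(6)[of a b] by (simp only: d_def list.map prod_list.Cons)
  have r: "Re r < 0" and left: "\<And>r. r \<in> set rs \<Longrightarrow> Re r < 0"
    using Cons.prems(5) by auto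
  have addl: "\<phi> (b + c) a = \<phi> b a + \<phi> c a" for a b c
    unfolding herm[of "b + c" a] herm[of b a] herm[of c a] add by simp
  have smultl: "\<phi> (smult c b) a = cnj c * \<phi> b a" for a b c
    unfolding herm[of "smult c b" a] herm[of b a] smult by simp
  have zerol: "\<phi> 0 a = 0" and zeror: "\<phi> a 0 = 0" for a
    using smultl[of 0 0 a] smult[of a 0 0] by simp_all
  have X: "pCons 0 (d * b) = smult r (d * b) + [:- r, 1:] * d * b" for b
    by (simp add: algebra_simps)
  have Xd: "\<phi> a (pCons 0 (d * b)) = r * \<phi> a (d * b)" for a b
    by (subst X) (simp only: add smult null add_0_right)
  show ?case
  proof (cases "Re (\<phi> d d) = 0")
    case True
    have "Im (\<phi> d d) = 0"
      using arg_cong[OF herm[of d d], of Im] by simp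
    then have dd: "\<phi> d d = 0" using True by (simp add: complex_eq_iff)
    \<comment> \<open>As \<phi> d d = 0, the dissipation inequality at u d + b has no term quadratic
      in u, so its linear term must vanish.\<close>
    have step: "\<phi> d (pCons 0 b) + cnj r * \<phi> d b = 0" for b
    proof (rule hermitian_null_vector)
      fix t
      define u where "u = - cnj t"
      have "pCons 0 (smult u d + b) = smult u (pCons 0 d) + pCons 0 b"
        by simp
      then have "\<phi> (smult u d + b) (pCons 0 (smult u d + b)) =
          cnj u * \<phi> d (pCons 0 b) + (u * r * \<phi> b d + \<phi> b (pCons 0 b))"
        using Xd[of d 1] Xd[of b 1] by (simp add: add addl smult smultl dd del: smult_pCons)
      also have "u * r * \<phi> b d = cnj (cnj u * cnj r * \<phi> d b)"
        using herm[of b d] by simp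
      finally have "Re (cnj u * \<phi> d (pCons 0 b) + (cnj (cnj u * cnj r * \<phi> d b) + \<phi> b (pCons 0 b))) \<le> 0"
        using diss by metis
      then show "0 \<le> - 2 * Re (\<phi> b (pCons 0 b)) + 2 * Re (t * (\<phi> d (pCons 0 b) + cnj r * \<phi> d b))"
        by (simp add: u_def algebra_simps)
    qed
    have "\<phi> d b = 0" for b
    proof -
      \<comment> \<open>By \<open>step\<close>, X acts inside \<phi> d as the scalar ?s, so \<phi> d
        (?D b) = ?D(?s) \<phi> d b. The left side is 0 by \<open>null\<close>, and ?s lies in the
        right half plane while all roots of ?D lie in the left one.\<close>
      let ?D = "[:- r, 1:] * d" and ?s = "- cnj r"
      have "[:- ?s, 1:] dvd ?D - [:poly ?D ?s:]"
        by (subst poly_eq_0_iff_dvd[symmetric]) simp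
      then obtain q where q: "?D - [:poly ?D ?s:] = [:- ?s, 1:] * q" by (elim dvdE)
      have "?D * b = pCons 0 (q * b) + (smult (cnj r) (q * b) + smult (poly ?D ?s) b)"
      proof -
        have "?D * b = ([:- ?s, 1:] * q + [:poly ?D ?s:]) * b"
          using q by (simp add: diff_eq_eq)
        then show ?thesis by (simp add: algebra_simps)
      qed
      then have "\<phi> d (?D * b) = (\<phi> d (pCons 0 (q * b)) + cnj r * \<phi> d (q * b)) + poly ?D ?s * \<phi> d b"
        by (simp only: add smult) simp
      then have "poly ?D ?s * \<phi> d b = 0"
        using step null by simp
      moreover have "poly ?D ?s \<noteq> 0"
      proof -
        have ne: "- cnj r - x \<noteq> 0" if "Re x < 0" for x
          using that r by (auto simp: complex_eq_iff)
        have "poly d ?s = (\<Prod>x\<leftarrow>rs. - cnj r - x)"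
          unfolding d_def by (induction rs) (simp_all add: algebra_simps)
        then have "poly d ?s \<noteq> 0"
          using ne left by (auto simp: prod_list_zero_iff)
        moreover have "poly ?D ?s = (?s - r) * poly d ?s" by (simp add: algebra_simps)
        ultimately show ?thesis using ne[OF r] by simp
      qed
      ultimately show ?thesis by simp
    qed
    note d0 = this
    have null': "\<phi> b (d * c) = 0" for b c
    proof -
      have "\<phi> (d * c) b = 0"
      proof (induction c arbitrary: b)
        case 0
        then show ?case by (simp add: zerol)
      next
        case (pCons k c)
        have "\<phi> (d * c) (pCons 0 b) = 0" by (rule pCons.IH)
        have "\<phi> b (pCons 0 (d * c)) = r * \<phi> b (d * c)" by (rule Xd)
        also have "\<phi> b (d * c) = 0" using pCons.IH[of b] herm[of b "d * c"] by simp
        finally have "\<phi> (pCons 0 (d * c)) b = 0" using herm[of "pCons 0 (d * c)" b] by simp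
        then show ?case by (simp add: addl smultl d0)
      qed
      then show ?thesis using herm[of b "d * c"] by simp
    qed
    then show ?thesis
      by (intro Cons.IH add smult herm diss left) (auto simp: d_def)
  next
    case False
    define \<delta> where "\<delta> = \<phi> d d"
    have \<delta>: "\<delta> = of_real (Re \<delta>)" "Re \<delta> \<noteq> 0"
      using False arg_cong[OF herm[of d d], of Im] by (simp_all add: \<delta>_def complex_eq_iff)
    have ne: "\<delta> \<noteq> 0" using \<delta>(2) by auto
    have "Re (\<phi> d (pCons 0 d)) = Re r * Re \<delta>"
      using Xd[of d 1] arg_cong[OF \<delta>(1), of Im] by (simp add: \<delta>_def)
    with diss[of d] have "Re r * Re \<delta> \<le> 0" by simp
    with r \<delta>(2) have pos: "Re \<delta> > 0"
      by (simp add: mult_le_0_iff)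
    define \<phi>' where "\<phi>' a b = \<phi> a b - \<phi> a d * \<phi> d b / \<delta>" for a b
    define pr where "pr a = a + smult (- \<phi> d a / \<delta>) d" for a
    have prd: "\<phi> d (pr a) = 0" for a
      unfolding pr_def add smult using ne by (simp add: \<delta>_def[symmetric])
    have herm': "\<phi>' b a = cnj (\<phi>' a b)" for a b
    proof -
      have "cnj \<delta> = \<delta>" unfolding \<delta>_def by (rule herm[symmetric])
      then show ?thesis using herm[of b a] herm[of d a] herm[of b d]
        by (simp add: \<phi>'_def)
    qed
    have add': "\<phi>' a (b + c) = \<phi>' a b + \<phi>' a c" for a b c
      by (simp add: \<phi>'_def add algebra_simps add_divide_distrib)
    have smult': "\<phi>' a (smult c b) = c * \<phi>' a b" for a b c
      by (simp add: \<phi>'_def smult algebra_simps)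
    have d': "\<phi>' a d = 0" for a
      using ne by (auto simp: \<phi>'_def \<delta>_def[symmetric])
    have d'l: "\<phi>' d a = 0" for a using herm'[of d a] d'[of a] by simp
    have Xd': "\<phi>' a (pCons 0 (d * b)) = r * \<phi>' a (d * b)" for a b
      unfolding \<phi>'_def Xd by (simp add: algebra_simps)
    have diss': "Re (\<phi>' a (pCons 0 a)) \<le> 0" for a
    proof -
      have a: "a = pr a + smult (\<phi> d a / \<delta>) d"
        by (simp add: pr_def)
      have addl': "\<phi>' (b + smult c d) x = \<phi>' b x" for b c x
        unfolding herm'[of "b + smult c d" x] herm'[of b x] add' smult' d' by simp
      have "\<phi>' a (pCons 0 a) = \<phi>' (pr a) (pCons 0 a)"
        by (subst a) (simp only: addl')
      also have "\<dots> = \<phi>' (pr a) (pCons 0 (pr a + smult (\<phi> d a / \<delta>) d))"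
        by (subst (2) a) simp
      also have "pCons 0 (pr a + smult (\<phi> d a / \<delta>) d) =
          pCons 0 (pr a) + smult (\<phi> d a / \<delta>) (pCons 0 (d * 1))"
        by simp
      also have "\<phi>' (pr a) \<dots> = \<phi>' (pr a) (pCons 0 (pr a))"
        by (simp only: add' smult' Xd') (simp add: d')
      also have "\<dots> = \<phi> (pr a) (pCons 0 (pr a))"
        using prd[of a] herm[of "pr a" d] by (simp add: \<phi>'_def)
      finally show ?thesis using diss[of "pr a"] by simp
    qed
    have "\<phi>' (d * c) b = 0" for b c
    proof (induction c arbitrary: b)
      case 0
      then show ?case by (simp add: \<phi>'_def zerol)
    next
      case (pCons k c)
      have "\<phi>' b (pCons 0 (d * c)) = r * \<phi>' b (d * c)" by (rule Xd')
      also have "\<phi>' b (d * c) = 0" using pCons.IH[of b] herm'[of b "d * c"] by simp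
      finally have "\<phi>' b (d * pCons k c) = 0"
        by (simp add: add' smult' d')
      then show ?case using herm'[of "d * pCons k c" b] by simp
    qed
    then have null': "\<phi>' b (d * c) = 0" for b c
      using herm'[of b "d * c"] by simp
    have "0 \<le> Re (\<phi>' a a)"
      by (rule Cons.IH[OF add' smult' herm' diss' left]) (use null' in \<open>auto simp: d_def\<close>)
    moreover have "0 \<le> Re (\<phi> a d * \<phi> d a / \<delta>)"
    proof -
      have "\<phi> a d * \<phi> d a = of_real ((cmod (\<phi> d a))\<^sup>2)"
        unfolding herm[of a d] complex_norm_square by (simp add: mult.commute)
      then have "\<phi> a d * \<phi> d a / of_real (Re \<delta>) = of_real ((cmod (\<phi> d a))\<^sup>2 / Re \<delta>)"
        by simp
      then show ?thesis unfolding \<delta>(1)[symmetric] using pos by simp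
    qed
    ultimately show ?thesis by (simp add: \<phi>'_def)
  qed
qed

section \<open>The energy of a trajectory\<close>

lemma coeff_cnj_poly [simp]: "coeff (map_poly cnj f) i = cnj (coeff f i)"
  by (simp add: coeff_map_poly)

lemma sum_smult_right: "smult r (\<Sum>i\<in>I. f i) = (\<Sum>i\<in>I. smult r (f i))"
  by (induction I rule: infinite_finite_induct) (simp_all add: smult_add_right)

lemma cnj_poly_mult: "map_poly cnj (f * g) = map_poly cnj f * map_poly cnj g"
  by (rule poly_eqI) (simp add: coeff_mult)

lemma cnj_poly_cnj [simp]: "map_poly cnj (map_poly cnj f) = f"
  by (rule poly_eqI) simp

lemma cnj_poly_pCons: "map_poly cnj (pCons c f) = pCons (cnj c) (map_poly cnj f)"
  by (rule poly_eqI) (simp add: coeff_pCons split: nat.split)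

lemma cnj_pact: "cnj (pact f x k) = pact (map_poly cnj f) (\<lambda>i. cnj (x i)) k"
proof -
  have "degree (map_poly cnj f) \<le> degree f"
    by (rule degree_le) (simp add: coeff_eq_0)
  then show ?thesis by (simp add: pact_bound[of _ "degree f"])
qed

text \<open>Cramer's rule: polynomials in the shift commute, so the system may be multiplied by the
  adjugate of its matrix.\<close>

lemma pact_det_eq_0:
  assumes G: "\<And>a k. a < p \<Longrightarrow> (\<Sum>c<p. pact (G a c) (y c) k) = 0" and b: "b < p"
  shows "pact (det (mat p p (\<lambda>(a, c). G a c))) (y b) k = 0"
proof -
  let ?M = "mat p p (\<lambda>(a, c). G a c)"
  have M: "?M \<in> carrier_mat p p" by simp
  have adj: "(\<Sum>a<p. adj_mat ?M $$ (b, a) * G a c) = (if b = c then det ?M else 0)" if "c < p" for c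
  proof -
    have eq: "(adj_mat ?M * ?M) $$ (b, c) = (\<Sum>a<p. adj_mat ?M $$ (b, a) * G a c)"
      using b that adj_mat(1)[OF M] by (auto simp: scalar_prod_def atLeast0LessThan intro!: sum.cong)
    show ?thesis using b that unfolding eq[symmetric] by (simp add: adj_mat(3)[OF M])
  qed
  have "pact (det ?M) (y b) k = (\<Sum>c<p. pact (if b = c then det ?M else 0) (y c) k)"
    using b by (simp add: if_distrib if_distribR sum.delta' cong: if_cong)
  also have "\<dots> = (\<Sum>c<p. \<Sum>a<p. pact (adj_mat ?M $$ (b, a)) (pact (G a c) (y c)) k)"
    by (intro sum.cong refl) (simp add: adj[symmetric] pact_sum pact_mult)
  also have "\<dots> = (\<Sum>a<p. pact (adj_mat ?M $$ (b, a)) (\<lambda>k. \<Sum>c<p. pact (G a c) (y c) k) k)"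
    by (subst sum.swap) (simp add: pact_sum_seq)
  also have "\<dots> = (\<Sum>a<p. pact (adj_mat ?M $$ (b, a)) (\<lambda>k. 0) k)"
    using G by (intro sum.cong refl) simp
  finally show ?thesis by simp
qed

lemma poly_det:
  "poly (det (mat p p (\<lambda>(a, c). G a c))) z = det (mat p p (\<lambda>(a, c). poly (G a c) (z :: 'a :: comm_ring_1)))"
proof -
  interpret comm_ring_hom "\<lambda>f. poly f z" by unfold_locales simp_all
  have "map_mat (\<lambda>f. poly f z) (mat p p (\<lambda>(a, c). G a c)) = mat p p (\<lambda>(a, c). poly (G a c) z)"
    by (rule eq_matI) auto
  then show ?thesis by (metis hom_det)
qed

lemma complex_poly_roots_list:
  fixes f :: "complex poly"
  assumes "f \<noteq> 0"
  obtains rs where "f = smult (lead_coeff f) (\<Prod>r\<leftarrow>rs. [:- r, 1:])"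
    "\<And>r. r \<in> set rs \<Longrightarrow> poly f r = 0"
proof -
  obtain rs where rs: "mset rs = proots f" using ex_mset by blast
  have "f = smult (lead_coeff f) (\<Prod>r\<in>#proots f. [:- r, 1:])"
    by (rule complex_poly_decompose_multiset[symmetric])
  also have "(\<Prod>r\<in>#proots f. [:- r, 1:]) = (\<Prod>r\<leftarrow>rs. [:- r, 1:])"
    unfolding rs[symmetric] by (simp add: prod_mset_prod_list flip: mset_map)
  finally have "f = smult (lead_coeff f) (\<Prod>r\<leftarrow>rs. [:- r, 1:])" .
  moreover have "poly f r = 0" if "r \<in> set rs" for r
    using that rs assms by (metis set_mset_mset set_count_proots mem_Collect_eq)
  ultimately show thesis by (rule that)
qed

text \<open>Peeling off the factor X - r leaves, by induction, the zero sequence; hence x is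
  geometric with ratio r, and h acts on it as the nonzero scalar h(r).\<close>

lemma pact_no_common_root:
  fixes x :: "nat \<Rightarrow> complex"
  assumes "\<And>k. pact (\<Prod>r\<leftarrow>rs. [:- r, 1:]) x k = 0" "\<And>k. pact h x k = 0"
    "\<And>r. r \<in> set rs \<Longrightarrow> poly h r \<noteq> 0"
  shows "x k = 0"
  using assms
proof (induction rs arbitrary: x k)
  case Nil
  then show ?case by simp
next
  case (Cons r rs)
  let ?x = "pact [:- r, 1:] x"
  have "?x k = 0" for k
  proof (rule Cons.IH)
    show "pact (\<Prod>r\<leftarrow>rs. [:- r, 1:]) ?x k = 0" for k
      using Cons.prems(1)[of k] by (simp only: list.map prod_list.Cons pact_mult pact_commute[of "[:- r, 1:]"])
    have "pact h x = (\<lambda>k. 0)" using Cons.prems(2) by (rule ext)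
    then show "pact h ?x k = 0" for k
      by (simp add: pact_commute[of h])
    show "poly h s \<noteq> 0" if "s \<in> set rs" for s using Cons.prems(3) that by simp
  qed
  then have "x (Suc k) = r * x k" for k
    by (simp add: pact_pCons)
  then have "x k = r ^ k * x 0" for k
    by (induction k) simp_all
  then have geo: "x = (\<lambda>k. r ^ k * x 0)" by (rule ext)
  have "poly h r * r ^ 0 * x 0 = 0"
    using Cons.prems(2)[of 0] by (subst (asm) geo) (simp only: pact_geometric)
  then have "x 0 = 0" using Cons.prems(3)[of r] by simp
  then show ?case by (subst geo) simp
qed

text \<open>\<open>\<sigma> a b k\<close> stands for the \<open>(a, b)\<close> entry of \<open>(- 1)\<^sup>k s\<^sub>k\<close>; the kernel condition says that
  \<open>(\<Sum>k. \<sigma>\<^sub>k z\<^sup>-\<^sup>k\<^sup>-\<^sup>1) E(z)\<close> is a polynomial.\<close>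

locale hankel_kernel =
  fixes p m :: nat and E :: "nat \<Rightarrow> nat \<Rightarrow> complex poly" and \<sigma> :: "nat \<Rightarrow> nat \<Rightarrow> nat \<Rightarrow> complex"
  assumes degree_E: "degree (E a b) \<le> m"
    and kernel: "a < p \<Longrightarrow> c < p \<Longrightarrow> (\<Sum>b<p. pact (E b c) (\<sigma> a b) k) = 0"
    and herm: "a < p \<Longrightarrow> b < p \<Longrightarrow> cnj (\<sigma> a b k) = \<sigma> b a k"
begin

text \<open>On coefficient vectors this is the block Hankel form of \<open>\<sigma>\<close>. It sees
  the two arguments only through products of their entries, which is why multiplication by the
  indeterminate is selfadjoint.\<close>

definition form :: "(nat \<Rightarrow> complex poly) \<Rightarrow> (nat \<Rightarrow> complex poly) \<Rightarrow> complex" where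
  "form f g = (\<Sum>a<p. \<Sum>b<p. pact (map_poly cnj (f a) * g b) (\<sigma> a b) 0)"

lemma form_cong:
  "(\<And>a. a < p \<Longrightarrow> f a = f' a) \<Longrightarrow> (\<And>a. a < p \<Longrightarrow> g a = g' a) \<Longrightarrow> form f g = form f' g'"
  by (simp add: form_def)

lemma form_herm: "form g f = cnj (form f g)"
proof -
  have "cnj (form f g) = (\<Sum>a<p. \<Sum>b<p. pact (map_poly cnj (g b) * f a) (\<sigma> b a) 0)"
    unfolding form_def cnj_sum by (intro sum.cong refl)
      (simp add: cnj_pact herm cnj_poly_mult mult.commute)
  also have "\<dots> = form g f" unfolding form_def by (rule sum.swap)
  finally show ?thesis by simp
qed

lemma form_add_right: "form f (\<lambda>a. g a + h a) = form f g + form f h"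
  by (simp add: form_def distrib_left pact_add sum.distrib)

lemma form_diff_right: "form f (\<lambda>a. g a - h a) = form f g - form f h"
  by (simp add: form_def right_diff_distrib pact_diff sum_subtractf)

lemma form_smult_right: "form f (\<lambda>a. smult c (g a)) = c * form f g"
  by (simp add: form_def pact_smult sum_distrib_left)

lemma form_0_right [simp]: "form f (\<lambda>a. 0) = 0"
  by (simp add: form_def)

lemma form_0_left [simp]: "form (\<lambda>a. 0) f = 0"
  by (simp add: form_def)

lemma form_add_left: "form (\<lambda>a. g a + h a) f = form g f + form h f"
  by (simp add: form_herm[of _ f] form_add_right)

lemma form_diff_left: "form (\<lambda>a. g a - h a) f = form g f - form h f"
  by (simp add: form_herm[of _ f] form_diff_right)

lemma form_pCons_0: "form (\<lambda>a. pCons 0 (f a)) g = form f (\<lambda>a. pCons 0 (g a))"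
  by (simp add: form_def cnj_poly_pCons)

text \<open>The columns of E lie in the radical by \<open>kernel\<close>, so subtracting
  combinations of them to lower a degree is invisible to the form.\<close>

lemma form_E_right: "form f (\<lambda>b. \<Sum>c<p. smult (v c) (E b c)) = 0"
proof -
  have "(\<Sum>b<p. pact (map_poly cnj (f a) * (\<Sum>c<p. smult (v c) (E b c))) (\<sigma> a b) 0) = 0"
    if "a < p" for a
  proof -
    have "(\<Sum>b<p. pact (map_poly cnj (f a) * (\<Sum>c<p. smult (v c) (E b c))) (\<sigma> a b) 0) =
      (\<Sum>b<p. \<Sum>c<p. v c * pact (map_poly cnj (f a)) (pact (E b c) (\<sigma> a b)) 0)"
      by (simp add: pact_mult sum_distrib_left pact_sum pact_smult)
    also have "\<dots> = (\<Sum>c<p. v c * pact (map_poly cnj (f a)) (\<lambda>k. \<Sum>b<p. pact (E b c) (\<sigma> a b) k) 0)"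
      by (subst sum.swap) (simp add: pact_sum_seq sum_distrib_left)
    also have "\<dots> = (\<Sum>c<p. v c * pact (map_poly cnj (f a)) (\<lambda>k. 0) 0)"
      using kernel that by (intro sum.cong refl) simp
    finally show ?thesis by simp
  qed
  then show ?thesis by (simp add: form_def)
qed

lemma form_E_left: "form (\<lambda>b. \<Sum>c<p. smult (v c) (E b c)) f = 0"
  by (simp add: form_herm[of _ f] form_E_right)

text \<open>Symmetry of the divided difference exchanges \<open>\<sigma>\<close> and the trajectory:
  the state becomes the polynomial \<open>dquot\<close> of E along \<open>\<sigma>\<close>, acting
  on \<open>y\<close>. That polynomial is the odd part without its contribution from s_{-1}.\<close>

lemma form_const_dquot:
  "form (\<lambda>a. [:e a:]) (\<lambda>b. \<Sum>c<p. dquot (E b c) (y c)) =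
    (\<Sum>a<p. cnj (e a) * (\<Sum>c<p. pact (\<Sum>b<p. dquot (E b c) (\<sigma> a b)) (y c) 0))"
proof -
  have "(\<Sum>b<p. pact (map_poly cnj [:e a:] * (\<Sum>c<p. dquot (E b c) (y c))) (\<sigma> a b) 0) =
     cnj (e a) * (\<Sum>c<p. pact (\<Sum>b<p. dquot (E b c) (\<sigma> a b)) (y c) 0)" for a
  proof -
    have "(\<Sum>b<p. pact (map_poly cnj [:e a:] * (\<Sum>c<p. dquot (E b c) (y c))) (\<sigma> a b) 0) =
       cnj (e a) * (\<Sum>b<p. \<Sum>c<p. pact (dquot (E b c) (y c)) (\<sigma> a b) 0)"
      by (simp add: cnj_poly_pCons pact_smult pact_sum sum_distrib_left)
    also have "(\<Sum>b<p. \<Sum>c<p. pact (dquot (E b c) (y c)) (\<sigma> a b) 0) =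
       (\<Sum>c<p. pact (\<Sum>b<p. dquot (E b c) (\<sigma> a b)) (y c) 0)"
      by (subst sum.swap) (simp add: pact_sum pact_dquot_commute[of _ "y _"])
    finally show ?thesis .
  qed
  then show ?thesis by (simp add: form_def)
qed

end

text \<open>\<open>C\<close> is the constant term \<open>s\<^sub>-\<^sub>1\<close>, or \<open>0\<close> in even degree. In a trajectory \<open>y\<close> the component
  comes before the time; \<open>st j y\<close>, \<open>ev j y\<close> and \<open>od j y\<close> sample it at the times \<open>j, j + 2, \<dots>\<close>.\<close>

locale hankel_system = hankel_kernel +
  fixes C :: "nat \<Rightarrow> nat \<Rightarrow> complex"
  assumes herm_C: "a < p \<Longrightarrow> b < p \<Longrightarrow> cnj (C a b) = C b a"
begin

text \<open>The polynomial (C + (\<Sum>k. \<sigma>_k z^(-k-1))) E(z), that is, the odd part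
  recovered from the Markov parameters: \<open>dquot\<close> is the polynomial part of series times
  E, and \<open>kernel\<close> removes the rest.\<close>

definition Od :: "nat \<Rightarrow> nat \<Rightarrow> complex poly" where
  "Od a c = (\<Sum>b<p. dquot (E b c) (\<sigma> a b)) + (\<Sum>b<p. smult (C a b) (E b c))"

definition F :: "nat \<Rightarrow> nat \<Rightarrow> complex poly" where
  "F a c = pcompose (E a c) [:0, 0, 1:] + pCons 0 (pcompose (Od a c) [:0, 0, 1:])"

definition traj :: "(nat \<Rightarrow> nat \<Rightarrow> complex) \<Rightarrow> bool" where
  "traj y \<longleftrightarrow> (\<forall>a<p. \<forall>k. (\<Sum>c<p. pact (F a c) (y c) k) = 0)"

definition st :: "nat \<Rightarrow> (nat \<Rightarrow> nat \<Rightarrow> complex) \<Rightarrow> nat \<Rightarrow> complex poly" where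
  "st j y b = (\<Sum>c<p. dquot (E b c) (\<lambda>k. y c (2 * k + j)))"

definition ev :: "nat \<Rightarrow> (nat \<Rightarrow> nat \<Rightarrow> complex) \<Rightarrow> nat \<Rightarrow> complex" where
  "ev j y a = (\<Sum>c<p. pact (E a c) (\<lambda>k. y c (2 * k + j)) 0)"

definition od :: "nat \<Rightarrow> (nat \<Rightarrow> nat \<Rightarrow> complex) \<Rightarrow> nat \<Rightarrow> complex" where
  "od j y a = (\<Sum>c<p. pact (Od a c) (\<lambda>k. y c (2 * k + j)) 0)"

text \<open>The minus sign is the one contained in \<open>\<sigma>\<close>: since
  \<open>\<sigma>\<close> alternates, the form of s_{k+1} is minus \<open>form\<close> with one
  factor W.\<close>

definition energy :: "(nat \<Rightarrow> nat \<Rightarrow> complex) \<Rightarrow> (nat \<Rightarrow> nat \<Rightarrow> complex) \<Rightarrow> complex" where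
  "energy y y' = form (st 1 y) (st 1 y') - form (st 0 y) (\<lambda>b. pCons 0 (st 0 y' b))
     + (\<Sum>a<p. \<Sum>b<p. cnj (ev 0 y a) * C a b * ev 0 y' b)"

abbreviation sh :: "(nat \<Rightarrow> nat \<Rightarrow> complex) \<Rightarrow> nat \<Rightarrow> nat \<Rightarrow> complex" where
  "sh y \<equiv> (\<lambda>c k. y c (Suc k))"

lemma st_sh: "st j (sh y) = st (Suc j) y"
  and ev_sh: "ev j (sh y) = ev (Suc j) y"
  by (simp_all add: st_def ev_def fun_eq_iff)

lemma traj_sh: "traj y \<Longrightarrow> traj (sh y)"
  unfolding traj_def using pact_shift[of _ "y _" 1] by simp

lemma traj_pact: assumes "traj y" shows "traj (\<lambda>c. pact h (y c))"
  unfolding traj_def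
proof (intro allI impI)
  fix a k assume "a < p"
  then have "(\<lambda>k. \<Sum>c<p. pact (F a c) (y c) k) = (\<lambda>k. 0)"
    using assms by (simp add: traj_def)
  then have "pact h (\<lambda>k. \<Sum>c<p. pact (F a c) (y c) k) k = 0" by simp
  then show "(\<Sum>c<p. pact (F a c) (pact h (y c)) k) = 0"
    by (simp add: pact_sum_seq pact_commute[of h])
qed

text \<open>\<open>dquot_shift\<close> for the square of the shift. The last sum is in the radical
  of \<open>form\<close>, so two time steps multiply a state by W and add the constant
  \<open>ev j y\<close>.\<close>

lemma st_Suc_Suc:
  "st (Suc (Suc j)) y b = pCons 0 (st j y b) + [:ev j y b:] - (\<Sum>c<p. smult (y c j) (E b c))"
proof -
  have pC: "(\<Sum>c<p. pCons 0 (f c)) = pCons 0 (\<Sum>c<p. f c)" for f :: "nat \<Rightarrow> complex poly"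
    by (induction p) simp_all
  have c: "(\<Sum>c<p. [:f c:]) = [:\<Sum>c<p. f c:]" for f :: "nat \<Rightarrow> complex"
    by (induction p) simp_all
  have "st (Suc (Suc j)) y b = (\<Sum>c<p. dquot (E b c) (\<lambda>k. (\<lambda>i. y c (2 * i + j)) (Suc k)))"
    by (simp add: st_def)
  also have "\<dots> = (\<Sum>c<p. pCons 0 (dquot (E b c) (\<lambda>k. y c (2 * k + j)))
      + [:pact (E b c) (\<lambda>k. y c (2 * k + j)) 0:] - smult (y c j) (E b c))"
    by (subst dquot_shift) simp
  finally show ?thesis
    by (simp only: sum_subtractf sum.distrib pC c st_def ev_def)
qed

lemma traj_ev_od:
  assumes "traj y" "a < p" shows "ev j y a + od (Suc j) y a = 0"
proof -
  have "(\<Sum>c<p. pact (F a c) (y c) j) = 0" using assms by (simp add: traj_def)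
  then show ?thesis
    by (simp add: F_def pact_add pact_pCons pact_subst_square ev_def od_def sum.distrib)
qed

lemma form_const_st:
  "form (\<lambda>a. [:e a:]) (st j y) =
    (\<Sum>a<p. cnj (e a) * od j y a) - (\<Sum>a<p. \<Sum>b<p. cnj (e a) * C a b * ev j y b)"
proof -
  have "form (\<lambda>a. [:e a:]) (st j y) = (\<Sum>a<p. cnj (e a) * (od j y a - (\<Sum>b<p. C a b * ev j y b)))"
  proof -
    have "(\<Sum>c<p. pact (\<Sum>b<p. dquot (E b c) (\<sigma> a b)) (\<lambda>k. y c (2 * k + j)) 0) =
      od j y a - (\<Sum>b<p. C a b * ev j y b)" for a
    proof -
      have "(\<Sum>c<p. \<Sum>b<p. C a b * pact (E b c) (\<lambda>k. y c (2 * k + j)) 0) =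
          (\<Sum>b<p. C a b * ev j y b)"
        by (subst sum.swap) (simp add: ev_def sum_distrib_left)
      then show ?thesis
        by (simp add: od_def Od_def pact_add pact_sum pact_smult sum.distrib)
    qed
    then show ?thesis
      by (simp only: form_const_dquot st_def[abs_def])
  qed
  then show ?thesis
    by (simp add: right_diff_distrib sum_subtractf sum_distrib_left mult.assoc)
qed

lemma herm_C_sum:
  "cnj (\<Sum>a<p. \<Sum>b<p. cnj (u a) * C a b * v b) = (\<Sum>a<p. \<Sum>b<p. cnj (v a) * C a b * u b)"
proof -
  have "cnj (\<Sum>a<p. \<Sum>b<p. cnj (u a) * C a b * v b) = (\<Sum>a<p. \<Sum>b<p. cnj (v b) * C b a * u a)"
    unfolding cnj_sum by (intro sum.cong refl) (simp add: herm_C algebra_simps)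
  then show ?thesis by (subst sum.swap)
qed

lemma energy_herm: "energy y' y = cnj (energy y y')"
proof -
  have "cnj (form (st 0 y) (\<lambda>b. pCons 0 (st 0 y' b))) = form (st 0 y') (\<lambda>b. pCons 0 (st 0 y b))"
    by (subst form_herm[symmetric]) (rule form_pCons_0)
  then show ?thesis
    by (simp add: energy_def herm_C_sum form_herm[of "st (Suc 0) y'" "st (Suc 0) y"] del: cnj_sum)
qed

text \<open>By \<open>st_Suc_Suc\<close> each term with \<open>st 2\<close> splits into a term with
  W, which cancels against the second summand of the energy, and the form of a constant with
  \<open>st 1\<close>. By \<open>form_const_st\<close> the latter yields \<open>od 1\<close>, equal
  to \<open>- ev 0\<close> on trajectories, and terms with \<open>C\<close> that cancel against the
  third summand.\<close>

lemma energy_dissipation: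
  assumes y: "traj y" and y': "traj y'"
  shows "energy (sh y) y' + energy y (sh y') = - 2 * (\<Sum>a<p. cnj (ev 0 y a) * ev 0 y' a)"
proof -
  have st2: "st 2 y = (\<lambda>b. pCons 0 (st 0 y b) + [:ev 0 y b:] - (\<Sum>c<p. smult (y c 0) (E b c)))" for y
    using st_Suc_Suc[of 0 y] by (simp add: fun_eq_iff numeral_2_eq_2)
  have left: "form (st 2 y) (st 1 y') = form (st 0 y) (\<lambda>b. pCons 0 (st 1 y' b))
      + form (\<lambda>b. [:ev 0 y b:]) (st 1 y')" for y y'
    unfolding st2 form_diff_left form_add_left form_E_left form_pCons_0 by simp
  have right: "form (st 1 y) (st 2 y') = form (st 1 y) (\<lambda>b. pCons 0 (st 0 y' b))
      + cnj (form (\<lambda>b. [:ev 0 y' b:]) (st 1 y))"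
    by (subst form_herm[of "st 1 y"], subst left, subst form_herm[of "st 1 y"])
      (simp add: form_pCons_0)
  have oe: "od 1 y a = - ev 0 y a" if "traj y" "a < p" for y a
    using traj_ev_od[OF that, of 0] by (simp add: eq_neg_iff_add_eq_0 add.commute)
  have const: "form (\<lambda>b. [:ev 0 z b:]) (st 1 w) = - (\<Sum>a<p. cnj (ev 0 z a) * ev 0 w a)
      - (\<Sum>a<p. \<Sum>b<p. cnj (ev 0 z a) * C a b * ev 1 w b)" if "traj w" for z w
    unfolding form_const_st using oe[OF that] by (simp add: sum_negf)
  have e: "energy (sh y) y' = form (st 2 y) (st 1 y') - form (st 1 y) (\<lambda>b. pCons 0 (st 0 y' b))
     + (\<Sum>a<p. \<Sum>b<p. cnj (ev 1 y a) * C a b * ev 0 y' b)"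
    "energy y (sh y') = form (st 1 y) (st 2 y') - form (st 0 y) (\<lambda>b. pCons 0 (st 1 y' b))
     + (\<Sum>a<p. \<Sum>b<p. cnj (ev 0 y a) * C a b * ev 1 y' b)"
    by (simp_all add: energy_def st_sh ev_sh numeral_2_eq_2)
  have sw: "cnj (\<Sum>a<p. cnj (ev 0 y' a) * ev 0 y a) = (\<Sum>a<p. cnj (ev 0 y a) * ev 0 y' a)"
    by (simp add: mult.commute)
  show ?thesis
    unfolding e left right const[OF y] const[OF y'] complex_cnj_diff complex_cnj_minus sw herm_C_sum
    by simp
qed

lemma st_add: "st j (\<lambda>c k. y c k + y' c k) = (\<lambda>b. st j y b + st j y' b)"
  and st_cmult: "st j (\<lambda>c k. r * y c k) = (\<lambda>b. smult r (st j y b))"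
  and ev_add: "ev j (\<lambda>c k. y c k + y' c k) = (\<lambda>b. ev j y b + ev j y' b)"
  and ev_cmult: "ev j (\<lambda>c k. r * y c k) = (\<lambda>b. r * ev j y b)"
  by (auto simp: st_def ev_def dquot_add_seq dquot_cmult_seq pact_add_seq pact_cmult_seq sum.distrib
      sum_distrib_left sum_smult_right)

lemma energy_add_right: "energy y (\<lambda>c k. y1 c k + y2 c k) = energy y y1 + energy y y2"
proof -
  have "form (st 0 y) (\<lambda>b. pCons 0 (st 0 y1 b + st 0 y2 b)) =
    form (st 0 y) (\<lambda>b. pCons 0 (st 0 y1 b)) + form (st 0 y) (\<lambda>b. pCons 0 (st 0 y2 b))"
    by (subst form_add_right[symmetric]) simp
  then show ?thesis
    by (simp add: energy_def st_add ev_add form_add_right distrib_left sum.distrib)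
qed

lemma energy_cmult_right: "energy y (\<lambda>c k. r * y1 c k) = r * energy y y1"
proof -
  have "form (st 0 y) (\<lambda>b. pCons 0 (smult r (st 0 y1 b))) = r * form (st 0 y) (\<lambda>b. pCons 0 (st 0 y1 b))"
    by (subst form_smult_right[symmetric]) simp
  then show ?thesis
    by (simp add: energy_def st_cmult ev_cmult form_smult_right algebra_simps sum_distrib_left)
qed

lemma energy_zero_right:
  assumes "\<And>c k. c < p \<Longrightarrow> y' c k = 0" shows "energy y y' = 0"
proof -
  have "st j y' = (\<lambda>b. 0)" "ev j y' = (\<lambda>b. 0)" for j
    using assms by (auto simp: st_def ev_def)
  then show ?thesis by (simp add: energy_def)
qed

section \<open>Definiteness of the energy when \<open>F\<close> is Hurwitz\<close>

definition hurwitz :: bool where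
  "hurwitz \<longleftrightarrow> (\<forall>z. det (mat p p (\<lambda>(a, c). poly (F a c) z)) = 0 \<longrightarrow> Re z < 0)"

lemma Re_energy_sh_le:
  assumes "traj y" shows "Re (energy y (sh y)) = - (\<Sum>a<p. (cmod (ev 0 y a))\<^sup>2)"
proof -
  have "(\<Sum>a<p. cnj (ev 0 y a) * ev 0 y a) = of_real (\<Sum>a<p. (cmod (ev 0 y a))\<^sup>2)"
    unfolding of_real_sum complex_norm_square by (simp add: mult.commute)
  then show ?thesis
    using arg_cong[OF energy_dissipation[OF assms assms], of Re] energy_herm[of "sh y" y] by simp
qed

text \<open>The matrix problem becomes scalar on the polynomials in the shift applied to the single
  trajectory \<open>y\<close>: the energy pulls back to a form on complex polynomials, and det F
  annihilates every component of \<open>y\<close>.\<close>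

lemma energy_nonneg:
  assumes \<open>hurwitz\<close> and y: "traj y"
  shows "0 \<le> Re (energy y y)"
proof -
  let ?d = "det (mat p p (\<lambda>(a, c). F a c))"
  have left: "Re z < 0" if "poly ?d z = 0" for z
    using that \<open>hurwitz\<close> by (simp add: poly_det hurwitz_def)
  have "?d \<noteq> 0" using left[of 0] by auto
  then obtain rs where rs: "?d = smult (lead_coeff ?d) (\<Prod>r\<leftarrow>rs. [:- r, 1:])"
    and roots: "\<And>r. r \<in> set rs \<Longrightarrow> poly ?d r = 0"
    using complex_poly_roots_list by blast
  let ?D = "\<Prod>r\<leftarrow>rs. [:- r, 1:]"
  have D: "pact ?D (y c) = (\<lambda>k. 0)" if "c < p" for c
  proof
    fix k
    have "pact ?d (y c) k = 0"
      by (rule pact_det_eq_0) (use y that in \<open>auto simp: traj_def\<close>)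
    then show "pact ?D (y c) k = 0"
      using \<open>?d \<noteq> 0\<close> by (subst (asm) rs) (simp add: pact_smult)
  qed
  let ?w = "\<lambda>h c. pact h (y c)"
  have "0 \<le> Re (energy (?w 1) (?w 1))"
  proof (rule pos_form_of_left_roots[where \<phi> = "\<lambda>a b. energy (?w a) (?w b)" and rs = rs])
    show "energy (?w a) (?w (b + c)) = energy (?w a) (?w b) + energy (?w a) (?w c)" for a b c
      by (subst energy_add_right[symmetric]) (simp add: pact_add[abs_def])
    show "energy (?w a) (?w (smult c b)) = c * energy (?w a) (?w b)" for a b c
      by (subst energy_cmult_right[symmetric]) (simp add: pact_smult[abs_def])
    show "energy (?w b) (?w a) = cnj (energy (?w a) (?w b))" for a b
      by (rule energy_herm)
    show "Re (energy (?w a) (?w (pCons 0 a))) \<le> 0" for a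
    proof -
      have "?w (pCons 0 a) = sh (?w a)" by (simp add: fun_eq_iff pact_pCons)
      then show ?thesis
        using Re_energy_sh_le[OF traj_pact[OF y]] by (simp add: sum_nonneg)
    qed
    show "Re r < 0" if "r \<in> set rs" for r using left roots that by blast
    show "energy (?w a) (?w (?D * b)) = 0" for a b
      by (rule energy_zero_right) (simp add: mult.commute[of ?D] pact_mult D)
  qed
  moreover have "?w 1 = y" by (simp add: fun_eq_iff)
  ultimately show ?thesis by simp
qed

text \<open>On the radical of the energy the dissipation vanishes, so \<open>E\<close> and then \<open>O\<close> annihilate the
  trajectory, which therefore also satisfies the equation of \<open>F(- z)\<close>; the latter has no root in
  common with \<open>F\<close>.\<close>

lemma energy_definite:
  assumes \<open>hurwitz\<close> and y: "traj y" and zero: "Re (energy y y) = 0" and c: "c < p"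
  shows "y c k = 0"
proof -
  have traj_add: "traj (\<lambda>c k. t * y c k + y' c k)" if "traj y" "traj y'" for y y' t
    using that by (simp add: traj_def pact_add_seq pact_cmult_seq sum.distrib flip: sum_distrib_left)
  \<comment> \<open>For a semidefinite form a null vector is in the radical, so the energy pairs to
    0 with every trajectory.\<close>
  have null: "energy y y' = 0" if y: "traj y" "Re (energy y y) = 0" and y': "traj y'" for y y'
  proof (rule hermitian_null_vector)
    fix t
    let ?z = "\<lambda>c k. cnj t * y c k + y' c k"
    have "0 \<le> Re (energy ?z ?z)"
      by (rule energy_nonneg) (use \<open>hurwitz\<close> traj_add y y' in auto)
    also have "energy ?z ?z = cnj t * energy ?z y + energy ?z y'"
      by (simp only: energy_add_right energy_cmult_right)
    also have "energy ?z y = cnj (cnj t * energy y y + energy y y')"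
      by (subst energy_herm) (simp only: energy_add_right energy_cmult_right)
    also have "energy ?z y' = cnj (cnj t * energy y' y + energy y' y')"
      by (subst energy_herm) (simp only: energy_add_right energy_cmult_right)
    also have "energy y' y = cnj (energy y y')" by (rule energy_herm)
    finally have "0 \<le> Re (cnj t * cnj (cnj t * energy y y + energy y y') +
        cnj (cnj t * cnj (energy y y') + energy y' y'))" .
    moreover have "energy y y = 0"
      using y(2) arg_cong[OF energy_herm[of y y], of Im] by (simp add: complex_eq_iff)
    ultimately show "0 \<le> Re (energy y' y') + 2 * Re (t * energy y y')"
      by simp
  qed
  \<comment> \<open>The radical is invariant under the shift. With \<open>ev\<close> zero,
    \<open>energy_dissipation\<close> for \<open>?y\<close> and \<open>sh ?y\<close> moves one shift
    to the other side, where \<open>null\<close> applies.\<close>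
  have iter: "traj (\<lambda>c i. y c (i + k)) \<and> Re (energy (\<lambda>c i. y c (i + k)) (\<lambda>c i. y c (i + k))) = 0" for k
  proof (induction k)
    case 0
    then show ?case using y zero by simp
  next
    case (Suc k)
    let ?y = "\<lambda>c i. y c (i + k)"
    have t: "traj ?y" and z: "Re (energy ?y ?y) = 0" using Suc by auto
    have ev: "ev 0 ?y a = 0" if "a < p" for a
    proof -
      have "(\<Sum>a<p. (cmod (ev 0 ?y a))\<^sup>2) = 0"
        using Re_energy_sh_le[OF t] null[OF t z traj_sh[OF t]] by simp
      then show ?thesis using that by (simp add: sum_nonneg_eq_0_iff)
    qed
    have "energy (sh ?y) (sh ?y) = - energy ?y (sh (sh ?y))"
      using energy_dissipation[OF t traj_sh[OF t]] ev by (simp add: eq_neg_iff_add_eq_0)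
    also have "\<dots> = 0" using null[OF t z traj_sh[OF traj_sh[OF t]]] by simp
    finally show ?case using traj_sh[OF t] by simp
  qed
  have ev0: "ev k y a = 0" if "a < p" for a k
  proof -
    let ?y = "\<lambda>c i. y c (i + k)"
    have t: "traj ?y" and z: "Re (energy ?y ?y) = 0" using iter by auto
    have "(\<Sum>a<p. (cmod (ev 0 ?y a))\<^sup>2) = 0"
      using Re_energy_sh_le[OF t] null[OF t z traj_sh[OF t]] by simp
    then have "ev 0 ?y a = 0" using that by (simp add: sum_nonneg_eq_0_iff)
    then show ?thesis by (simp add: ev_def)
  qed
  have od0: "od (Suc k) y a = 0" if "a < p" for a k
    using traj_ev_od[OF y that, of k] ev0[OF that] by simp
  let ?d = "det (mat p p (\<lambda>(a, c). F a c))"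
  let ?G = "\<lambda>a c. pcompose (E a c) [:0, 0, 1:] - pCons 0 (pcompose (Od a c) [:0, 0, 1:])"
  let ?h = "det (mat p p (\<lambda>(a, c). ?G a c))"
  have left: "Re z < 0" if "poly ?d z = 0" for z
    using that \<open>hurwitz\<close> by (simp add: poly_det hurwitz_def)
  have right: "0 < Re z" if "poly ?h z = 0" for z
  proof -
    have "poly (?G a c) z = poly (F a c) (- z)" for a c
      by (simp add: F_def poly_pcompose)
    then have "poly ?h z = poly ?d (- z)" by (simp only: poly_det)
    then show ?thesis using left[of "- z"] that by simp
  qed
  have "?d \<noteq> 0" using left[of 0] by auto
  then obtain rs where rs: "?d = smult (lead_coeff ?d) (\<Prod>r\<leftarrow>rs. [:- r, 1:])"
    and roots: "\<And>r. r \<in> set rs \<Longrightarrow> poly ?d r = 0"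
    using complex_poly_roots_list by blast
  have dy: "pact ?d (y c) k = 0" for k
    by (rule pact_det_eq_0) (use y c in \<open>auto simp: traj_def\<close>)
  have tail: "y c (Suc k) = 0" for k
  proof (rule pact_no_common_root[where x = "\<lambda>k. y c (Suc k)" and rs = rs and h = ?h])
    show "pact (\<Prod>r\<leftarrow>rs. [:- r, 1:]) (\<lambda>k. y c (Suc k)) k = 0" for k
    proof -
      have "pact ?d (\<lambda>k. y c (Suc k)) k = 0"
        using dy[of "k + 1"] pact_shift[of ?d "y c" 1 k] by simp
      then show ?thesis
        using \<open>?d \<noteq> 0\<close> by (subst (asm) rs) (simp add: pact_smult)
    qed
    show "pact ?h (\<lambda>k. y c (Suc k)) k = 0" for k
    proof (rule pact_det_eq_0[where y = "sh y"])
      show "(\<Sum>c<p. pact (?G a c) (\<lambda>k. y c (Suc k)) k) = 0" if "a < p" for a k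
        using ev0[OF that, of "Suc k"] od0[OF that, of "Suc k"]
        by (simp add: pact_diff pact_pCons pact_subst_square ev_def od_def sum_subtractf)
    qed (rule c)
    show "poly ?h r \<noteq> 0" if "r \<in> set rs" for r
      using left right roots[OF that] by fastforce
  qed
  \<comment> \<open>Writing det F as d(0) + X q(X), the second part sees only the vanishing tail,
    and d(0) is nonzero because 0 is not in the open left half plane.\<close>
  have "pact q (y c) (Suc 0) = 0" for q by (simp add: pact_def tail)
  then have "coeff ?d 0 * y c 0 = pact ?d (y c) 0"
    by (cases ?d) (simp add: pact_pCons)
  then have "coeff ?d 0 * y c 0 = 0" by (simp add: dy)
  moreover have "coeff ?d 0 \<noteq> 0" using left[of 0] by (auto simp: poly_0_coeff_0)
  ultimately show ?thesis using tail by (cases k) auto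
qed

end

section \<open>Realization of states\<close>

lemma regular_solve:
  fixes M :: "nat \<Rightarrow> nat \<Rightarrow> complex"
  assumes "det (mat p p (\<lambda>(a, c). M a c)) \<noteq> 0"
  shows "\<exists>v. \<forall>a<p. (\<Sum>c<p. M a c * v c) = r a"
proof -
  let ?M = "mat p p (\<lambda>(a, c). M a c)"
  have M: "?M \<in> carrier_mat p p" by simp
  let ?v = "\<lambda>c. \<Sum>b<p. adj_mat ?M $$ (c, b) * (r b / det ?M)"
  have "(\<Sum>c<p. M a c * ?v c) = r a" if "a < p" for a
  proof -
    have inv: "(\<Sum>c<p. M a c * adj_mat ?M $$ (c, b)) = (if a = b then det ?M else 0)" if "b < p" for b
    proof -
      have eq: "(?M * adj_mat ?M) $$ (a, b) = (\<Sum>c<p. M a c * adj_mat ?M $$ (c, b))"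
        using \<open>a < p\<close> that adj_mat(1)[OF M]
        by (auto simp: scalar_prod_def atLeast0LessThan intro!: sum.cong)
      show ?thesis using \<open>a < p\<close> that unfolding eq[symmetric] by (simp add: adj_mat(2)[OF M])
    qed
    have "(\<Sum>c<p. M a c * ?v c) = (\<Sum>c<p. \<Sum>b<p. M a c * adj_mat ?M $$ (c, b) * (r b / det ?M))"
      by (simp only: sum_distrib_left mult.assoc)
    also have "\<dots> = (\<Sum>b<p. (\<Sum>c<p. M a c * adj_mat ?M $$ (c, b)) * (r b / det ?M))"
      by (subst sum.swap) (simp only: sum_distrib_right)
    also have "\<dots> = (\<Sum>b<p. if a = b then r b else 0)"
      using assms by (intro sum.cong refl) (simp add: inv)
    finally show ?thesis using that by simp
  qed
  then show ?thesis by (intro exI[of _ ?v]) simp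
qed

lemma singular_null_vector:
  fixes M :: "nat \<Rightarrow> nat \<Rightarrow> complex"
  shows "det (mat p p (\<lambda>(a, c). M a c)) = 0 \<longleftrightarrow>
    (\<exists>v. (\<exists>c<p. v c \<noteq> 0) \<and> (\<forall>a<p. (\<Sum>c<p. M a c * v c) = 0))"
proof -
  let ?M = "mat p p (\<lambda>(a, c). M a c)"
  have mult: "(?M *\<^sub>v v) $ a = (\<Sum>c<p. M a c * v $ c)" if "v \<in> carrier_vec p" "a < p" for v a
    using that by (auto simp: scalar_prod_def atLeast0LessThan intro!: sum.cong)
  have "det ?M = 0 \<longleftrightarrow> (\<exists>v. v \<in> carrier_vec p \<and> v \<noteq> 0\<^sub>v p \<and> ?M *\<^sub>v v = 0\<^sub>v p)"
    by (rule det_0_iff_vec_prod_zero) simp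
  also have "\<dots> \<longleftrightarrow> (\<exists>v. (\<exists>c<p. v c \<noteq> 0) \<and> (\<forall>a<p. (\<Sum>c<p. M a c * v c) = 0))"
  proof
    assume "\<exists>v. v \<in> carrier_vec p \<and> v \<noteq> 0\<^sub>v p \<and> ?M *\<^sub>v v = 0\<^sub>v p"
    then obtain v where v: "v \<in> carrier_vec p" "v \<noteq> 0\<^sub>v p" "?M *\<^sub>v v = 0\<^sub>v p" by blast
    have "\<exists>c<p. v $ c \<noteq> 0"
      using v(1,2) by (metis carrier_vecD eq_vecI index_zero_vec)
    moreover have "(\<Sum>c<p. M a c * v $ c) = 0" if "a < p" for a
      using mult[OF v(1) that] v(3) that by simp
    ultimately show "\<exists>v. (\<exists>c<p. v c \<noteq> 0) \<and> (\<forall>a<p. (\<Sum>c<p. M a c * v c) = 0)" by blast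
  next
    assume "\<exists>v. (\<exists>c<p. v c \<noteq> 0) \<and> (\<forall>a<p. (\<Sum>c<p. M a c * v c) = 0)"
    then obtain v c where v: "c < p" "v c \<noteq> 0" "\<forall>a<p. (\<Sum>c<p. M a c * v c) = 0" by blast
    have "vec p v \<noteq> 0\<^sub>v p"
      using v(1,2) by (metis index_vec index_zero_vec(1))
    moreover have "?M *\<^sub>v vec p v = 0\<^sub>v p"
    proof (rule eq_vecI)
      fix a assume "a < dim_vec (0\<^sub>v p :: complex vec)"
      then have "a < p" by simp
      then show "(?M *\<^sub>v vec p v) $ a = 0\<^sub>v p $ a"
        using v(3) by (subst mult) auto
    qed simp
    ultimately show "\<exists>v. v \<in> carrier_vec p \<and> v \<noteq> 0\<^sub>v p \<and> ?M *\<^sub>v v = 0\<^sub>v p"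
      using vec_carrier by blast
  qed
  finally show ?thesis .
qed

text \<open>Regularity gives a value for \<open>y k\<close> once the earlier ones are fixed;
  \<open>local\<close> says that the right side looks at nothing else, which is what well-founded
  choice requires.\<close>

lemma recursive_solve:
  fixes M :: "nat \<Rightarrow> nat \<Rightarrow> nat \<Rightarrow> complex"
  assumes regular: "\<And>k. det (mat p p (\<lambda>(a, c). M k a c)) \<noteq> 0"
    and local: "\<And>k y y'. (\<And>i. i < k \<Longrightarrow> y i = y' i) \<Longrightarrow> R k y = R k y'"
  shows "\<exists>y. \<forall>k. \<forall>a<p. (\<Sum>c<p. M k a c * y k c) = R k y a"
proof (rule dependent_wf_choice[of less_than "\<lambda>y k v. \<forall>a<p. (\<Sum>c<p. M k a c * v c) = R k y a"])
  show "(\<forall>a<p. (\<Sum>c<p. M k a c * v c) = R k y a) = (\<forall>a<p. (\<Sum>c<p. M k a c * v c) = R k y' a)"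
    if "\<And>i. (i, k) \<in> less_than \<Longrightarrow> y i = y' i" for y y' k v
    using local[of k y y'] that by simp
  show "\<exists>v. \<forall>a<p. (\<Sum>c<p. M k a c * v c) = R k y a" for k y
    by (rule regular_solve[OF regular])
qed simp

section \<open>Positivity of the shifted Hankel forms\<close>

context hankel_kernel
begin

definition lowdeg :: "nat \<Rightarrow> (nat \<Rightarrow> complex poly) \<Rightarrow> bool" where
  "lowdeg N f \<longleftrightarrow> (\<forall>a. \<forall>i\<ge>N. coeff (f a) i = 0)"

text \<open>Positive definiteness of the block matrix [s_{t+i+j}] with i, j < m, in the language of
  polynomials; \<open>hankel_pos_iff\<close> makes this precise.\<close>

definition hankel_pos :: "nat \<Rightarrow> bool" where
  "hankel_pos t \<longleftrightarrow> (\<forall>f. lowdeg m f \<and> (\<exists>a<p. f a \<noteq> 0) \<longrightarrow>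
     0 < Re ((- 1) ^ t * form f (\<lambda>a. monom 1 t * f a)))"

lemma form_monom: "form f (\<lambda>a. monom 1 t * g a) = form (\<lambda>a. monom 1 t * f a) g"
proof -
  have "map_poly cnj (monom 1 t) = monom 1 t"
    by (rule poly_eqI) simp
  then show ?thesis by (simp add: form_def cnj_poly_mult mult_ac)
qed

lemma hankel_pos_0: "hankel_pos 0 \<longleftrightarrow>
    (\<forall>f. lowdeg m f \<and> (\<exists>a<p. f a \<noteq> 0) \<longrightarrow> 0 < Re (form f f))"
  by (simp add: hankel_pos_def)

lemma hankel_pos_1: "hankel_pos 1 \<longleftrightarrow>
    (\<forall>f. lowdeg m f \<and> (\<exists>a<p. f a \<noteq> 0) \<longrightarrow> 0 < Re (- form f (\<lambda>a. pCons 0 (f a))))"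
  by (simp add: hankel_pos_def monom_Suc)

end

locale regular_hankel_system = hankel_system +
  fixes n :: nat
  assumes regular_E: "det (mat p p (\<lambda>(a, c). coeff (E a c) m)) \<noteq> 0"
    and regular_F: "det (mat p p (\<lambda>(a, c). coeff (F a c) n)) \<noteq> 0"
    and degree_F: "a < p \<Longrightarrow> c < p \<Longrightarrow> degree (F a c) \<le> n"
    and parity: "n = 2 * m \<or> n = 2 * m + 1"
    and even_C: "n = 2 * m \<Longrightarrow> C a b = 0"
begin

lemma coeff_st:
  "coeff (st j y a) i = (\<Sum>c<p. \<Sum>l\<in>{i<..m}. coeff (E a c) l * y c (2 * (l - 1 - i) + j))"
  by (simp add: st_def coeff_sum coeff_dquot_sum[OF degree_E])

lemma lowdeg_st: "lowdeg m (st j y)"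
  by (simp add: lowdeg_def coeff_st)

text \<open>The system for \<open>y\<close> is triangular. Prescribed state coefficients fix the
  times below 2 m, the value of \<open>ev\<close> fixes time 2 m in odd degree, and from time n on
  the equation of \<open>F\<close> decides. The newest value is always multiplied by a regular
  leading coefficient, of \<open>E\<close> or of \<open>F\<close>.\<close>

lemma realize:
  assumes f: "lowdeg m f" and g: "lowdeg m g"
  shows "\<exists>y. traj y \<and> (\<forall>b<p. st 0 y b = f b) \<and> (\<forall>b<p. st 1 y b = g b) \<and>
    (n = 2 * m + 1 \<longrightarrow> (\<forall>a<p. ev 0 y a = e a))"
proof -
  \<comment> \<open>Coefficient i of \<open>st j\<close> involves y at the times j, j + 2, ..., up
    to 2 (m - 1 - i) + j; \<open>?i k\<close> is the coefficient whose latest time is k, with j = k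
    mod 2.\<close>
  let ?i = "\<lambda>k. m - 1 - k div 2"
  define M where "M k a c = coeff (if k < n then E a c else F a c) (if k < n then m else n)" for k a c
  define R where "R k y a =
    (if k < 2 * m then coeff (if even k then f a else g a) (?i k)
        - (\<Sum>c<p. \<Sum>l\<in>{?i k<..<m}. coeff (E a c) l * y (2 * (l - 1 - ?i k) + k mod 2) c)
     else if k < n then e a - (\<Sum>c<p. \<Sum>l<m. coeff (E a c) l * y (2 * l) c)
     else - (\<Sum>c<p. \<Sum>l<n. coeff (F a c) l * y (k - n + l) c))" for k :: nat and y :: "nat \<Rightarrow> nat \<Rightarrow> complex" and a
  have "\<exists>y. \<forall>k. \<forall>a<p. (\<Sum>c<p. M k a c * y k c) = R k y a"
  proof (rule recursive_solve)
    show "det (mat p p (\<lambda>(a, c). M k a c)) \<noteq> 0" for k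
      using regular_E regular_F by (cases "k < n") (simp_all add: M_def)
    show "R k y = R k y'" if eq: "\<And>i. i < k \<Longrightarrow> y i = y' i" for k y y'
    proof
      fix a
      consider "k < 2 * m" | "2 * m \<le> k" "k < n" | "n \<le> k" by linarith
      then show "R k y a = R k y' a"
      proof cases
        case 1
        have "2 * (l - 1 - ?i k) + k mod 2 < k" if "l \<in> {?i k<..<m}" for l
        proof -
          have "l - 1 - ?i k < k div 2"
            using that 1 by (auto simp: less_diff_conv2)
          then have "2 * (l - 1 - ?i k) + k mod 2 < 2 * (k div 2) + k mod 2" by simp
          then show ?thesis by simp
        qed
        then show ?thesis using 1 eq by (simp add: R_def)
      next
        case 2
        then show ?thesis using eq by (simp add: R_def)
      next
        case 3
        then show ?thesis using parity eq by (auto simp: R_def intro!: sum.cong)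
      qed
    qed
  qed
  then obtain y where y: "\<And>k a. a < p \<Longrightarrow> (\<Sum>c<p. M k a c * y k c) = R k y a" by blast
  let ?y = "\<lambda>c k. y k c"
  have coeff: "coeff (st j ?y a) i = coeff (if j = 0 then f a else g a) i"
    if "a < p" "i < m" "j < 2" for a i j
  proof -
    let ?k = "2 * (m - 1 - i) + j"
    have k: "?k < 2 * m" "?k < n" "?i ?k = i" "?k mod 2 = j" "even ?k \<longleftrightarrow> j = 0"
      using that parity by auto
    have "{i<..m} = insert m {i<..<m}" using that by auto
    then have "coeff (st j ?y a) i = (\<Sum>c<p. M ?k a c * y ?k c)
       + (\<Sum>c<p. \<Sum>l\<in>{i<..<m}. coeff (E a c) l * y (2 * (l - 1 - i) + j) c)"
      using k(2) by (simp add: coeff_st M_def sum.distrib diff_commute)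
    also have "\<dots> = coeff (if j = 0 then f a else g a) i"
      unfolding y[OF that(1)] R_def k(3,4,5) using k(1) by simp
    finally show ?thesis .
  qed
  have "st 0 ?y a = f a" "st 1 ?y a = g a" if "a < p" for a
  proof -
    have "coeff (st 0 ?y a) i = coeff (f a) i" "coeff (st 1 ?y a) i = coeff (g a) i" for i
      using coeff[OF that, of i] f g lowdeg_st[of _ ?y]
      by (cases "i < m"; simp add: lowdeg_def)+
    then show "st 0 ?y a = f a" "st 1 ?y a = g a" by (auto intro: poly_eqI)
  qed
  moreover have "ev 0 ?y a = e a" if "a < p" "n = 2 * m + 1" for a
  proof -
    have "ev 0 ?y a = (\<Sum>c<p. \<Sum>l\<le>m. coeff (E a c) l * y (2 * l) c)"
      by (simp add: ev_def pact_bound[OF degree_E])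
    also have "\<dots> = (\<Sum>c<p. M (2 * m) a c * y (2 * m) c)
        + (\<Sum>c<p. \<Sum>l<m. coeff (E a c) l * y (2 * l) c)"
      using that(2) by (simp add: M_def sum.distrib flip: lessThan_Suc_atMost)
    also have "\<dots> = e a"
      unfolding y[OF that(1)] R_def using that(2) by simp
    finally show ?thesis .
  qed
  moreover have "traj ?y"
    unfolding traj_def
  proof (intro allI impI)
    fix a k assume "a < p"
    have "(\<Sum>c<p. pact (F a c) (?y c) k) = (\<Sum>c<p. M (n + k) a c * y (n + k) c)
        + (\<Sum>c<p. \<Sum>l<n. coeff (F a c) l * y (l + k) c)"
      using \<open>a < p\<close> by (simp add: M_def pact_bound[OF degree_F] sum.distrib flip: lessThan_Suc_atMost)
    also have "\<dots> = 0"
      unfolding y[OF \<open>a < p\<close>] R_def using parity by (auto simp: add.commute)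
    finally show "(\<Sum>c<p. pact (F a c) (?y c) k) = 0" .
  qed
  ultimately show ?thesis by blast
qed

lemma hurwitz_imp_energy_pos:
  assumes hurwitz "lowdeg m f" "lowdeg m g"
    and ne: "(\<exists>a<p. f a \<noteq> 0) \<or> (\<exists>a<p. g a \<noteq> 0) \<or> (n = 2 * m + 1 \<and> (\<exists>a<p. e a \<noteq> 0))"
  shows "0 < Re (form g g - form f (\<lambda>a. pCons 0 (f a))
    + (\<Sum>a<p. \<Sum>b<p. cnj (e a) * C a b * e b))"
proof -
  obtain y where y: "traj y" "\<And>b. b < p \<Longrightarrow> st 0 y b = f b" "\<And>b. b < p \<Longrightarrow> st 1 y b = g b"
    "\<And>a. n = 2 * m + 1 \<Longrightarrow> a < p \<Longrightarrow> ev 0 y a = e a"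
    using realize[OF assms(2,3), of e] by blast
  \<comment> \<open>In even degree \<open>realize\<close> leaves \<open>ev 0 y\<close> uncontrolled,
    but there \<open>C\<close> is 0.\<close>
  have C: "(\<Sum>a<p. \<Sum>b<p. cnj (ev 0 y a) * C a b * ev 0 y b) = (\<Sum>a<p. \<Sum>b<p. cnj (e a) * C a b * e b)"
    using parity y(4) even_C by (auto intro!: sum.cong)
  have "energy y y = form g g - form f (\<lambda>a. pCons 0 (f a))
    + (\<Sum>a<p. \<Sum>b<p. cnj (e a) * C a b * e b)"
    unfolding energy_def C using y(2,3) by (auto intro!: arg_cong2[of _ _ _ _ "(-)"] form_cong)
  moreover have "Re (energy y y) \<noteq> 0"
  proof
    assume "Re (energy y y) = 0"
    then have "\<And>c k. c < p \<Longrightarrow> y c k = 0" using energy_definite[OF \<open>hurwitz\<close> y(1)] by blast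
    then have "st j y b = 0" "ev j y b = 0" for j b by (auto simp: st_def ev_def)
    with ne y(2-4) show False by auto
  qed
  ultimately show ?thesis using energy_nonneg[OF \<open>hurwitz\<close> y(1)] by simp
qed

text \<open>For a root z with Re z at least 0, the shift multiplies y_k = z^k u by z, so dissipation
  compares a nonnegative number with -|ev 0 y|^2 and \<open>ev 0 y\<close> must vanish. Then the
  state q of y is an eigenvector of W modulo the radical and is orthogonal to constants, hence to
  every polynomial vector, against positivity at q.\<close>

lemma hurwitz_of_pos:
  assumes pos: "hankel_pos 0" "hankel_pos 1"
    and C_pos: "\<And>v. n = 2 * m + 1 \<Longrightarrow> \<exists>c<p. v c \<noteq> 0 \<Longrightarrow>
      0 < Re (\<Sum>a<p. \<Sum>b<p. cnj (v a) * C a b * v b)"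
  shows hurwitz
proof -
  have False if det: "det (mat p p (\<lambda>(a, c). poly (F a c) z)) = 0" and z: "0 \<le> Re z" for z
  proof -
    obtain u where u: "\<exists>c<p. u c \<noteq> 0" "\<And>a. a < p \<Longrightarrow> (\<Sum>c<p. poly (F a c) z * u c) = 0"
      using det unfolding singular_null_vector by blast
    define y where "y = (\<lambda>c k. z ^ k * u c)"
    define q where "q = st 0 y"
    have traj: "traj y"
      unfolding traj_def
    proof (intro allI impI)
      fix a k assume "a < p"
      have "(\<Sum>c<p. pact (F a c) (y c) k) = z ^ k * (\<Sum>c<p. poly (F a c) z * u c)"
        unfolding y_def pact_geometric sum_distrib_left by (intro sum.cong refl) simp
      then show "(\<Sum>c<p. pact (F a c) (y c) k) = 0" using u(2)[OF \<open>a < p\<close>] by simp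
    qed
    have sh: "sh y = (\<lambda>c k. z * y c k)" by (simp add: y_def fun_eq_iff)
    have C_nonneg: "0 \<le> Re (\<Sum>a<p. \<Sum>b<p. cnj (v a) * C a b * v b)" for v
    proof (cases "n = 2 * m + 1 \<and> (\<exists>c<p. v c \<noteq> 0)")
      case True
      then show ?thesis using C_pos[of v] by simp
    next
      case False
      then have "(\<Sum>a<p. \<Sum>b<p. cnj (v a) * C a b * v b) = 0"
        using even_C parity by (auto intro!: sum.neutral)
      then show ?thesis by simp
    qed
    have "0 \<le> Re (form f f)" "Re (form f (\<lambda>b. pCons 0 (f b))) \<le> 0" if "lowdeg m f" for f
    proof -
      have "form f f = 0 \<and> form f (\<lambda>b. pCons 0 (f b)) = 0" if "\<forall>a<p. f a = 0"
        using form_cong[of f "\<lambda>a. 0"] that by simp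
      then show "0 \<le> Re (form f f)" "Re (form f (\<lambda>b. pCons 0 (f b))) \<le> 0"
        using that pos unfolding hankel_pos_0 hankel_pos_1 by (cases "\<forall>a<p. f a = 0"; force)+
    qed
    then have "0 \<le> Re (energy y y)"
      using lowdeg_st C_nonneg[of "ev 0 y"] unfolding energy_def minus_complex.sel plus_complex.sel
      by (meson add_nonneg_nonneg diff_ge_0_iff_ge order_trans)
    then have "0 \<le> Re z * Re (energy y y)" using z by simp
    also have "\<dots> = Re (z * energy y y)"
      using arg_cong[OF energy_herm[of y y], of Im] by simp
    also have "\<dots> = - (\<Sum>a<p. (cmod (ev 0 y a))\<^sup>2)"
      using Re_energy_sh_le[OF traj] by (simp only: sh energy_cmult_right)
    finally have "(\<Sum>a<p. (cmod (ev 0 y a))\<^sup>2) = 0"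
      by (smt (verit) sum_nonneg zero_le_power2)
    then have ev0: "ev 0 y a = 0" if "a < p" for a
      using that by (simp add: sum_nonneg_eq_0_iff)
    have X: "form g (\<lambda>b. pCons 0 (q b)) = z\<^sup>2 * form g q" for g
    proof -
      have "st 2 y = st 0 (sh (sh y))"
        using st_sh[of 0 "sh y"] st_sh[of "Suc 0" y] by (simp only: numeral_2_eq_2)
      also have "sh (sh y) = (\<lambda>c k. z\<^sup>2 * y c k)" by (simp add: y_def power2_eq_square fun_eq_iff)
      finally have "z\<^sup>2 * form g q = form g (st 2 y)"
        by (simp only: st_cmult q_def form_smult_right)
      also have "\<dots> = form g (\<lambda>b. pCons 0 (q b) - (\<Sum>c<p. smult (y c 0) (E b c)))"
        using st_Suc_Suc[of 0 y] ev0 by (intro form_cong) (simp_all add: q_def numeral_2_eq_2)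
      finally show ?thesis by (simp only: form_diff_right form_E_right diff_zero)
    qed
    obtain a0 where a0: "a0 < p" "(\<Sum>c<p. coeff (E a0 c) m * u c) \<noteq> 0"
      using regular_E u(1) unfolding singular_null_vector by blast
    \<comment> \<open>For m = 0 there are no states, and \<open>ev 0 y\<close> is itself the nonzero
      vector E_m u.\<close>
    have "m \<noteq> 0"
    proof
      assume "m = 0"
      then have "ev 0 y a0 = (\<Sum>c<p. coeff (E a0 c) m * u c)"
        by (simp add: ev_def pact_bound[OF degree_E] y_def)
      with a0 ev0 show False by simp
    qed
    have "{m - 1<..m} = {m}" using \<open>m \<noteq> 0\<close> by auto
    then have "coeff (q a0) (m - 1) = (\<Sum>c<p. coeff (E a0 c) m * u c)"
      using \<open>m \<noteq> 0\<close> by (simp add: q_def coeff_st y_def)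
    with a0 have "\<exists>a<p. q a \<noteq> 0" by (metis coeff_0)
    then have h0: "0 < Re (form q q)" and h1: "0 < Re (- form q (\<lambda>b. pCons 0 (q b)))"
      using pos lowdeg_st[of 0 y] unfolding hankel_pos_0 hankel_pos_1 q_def by blast+
    \<comment> \<open>By \<open>X\<close>, the form of q with W q is z^2 times the form of q with
      itself, and \<open>h1\<close> makes it nonzero.\<close>
    from h1 have "z \<noteq> 0" by (auto simp: X)
    have od0: "od 0 y a = 0" if "a < p" for a
    proof -
      have "od 1 y a = z * od 0 y a"
        by (simp add: od_def y_def sum_distrib_left mult.assoc flip: pact_cmult_seq)
      then show ?thesis
        using traj_ev_od[OF traj that, of 0] ev0[OF that] \<open>z \<noteq> 0\<close> by simp
    qed
    have const: "form (\<lambda>a. [:e a:]) q = 0" for e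
      unfolding q_def form_const_st using od0 ev0 by simp
    \<comment> \<open>Horner's scheme: selfadjointness moves each factor W to q, where it becomes
      z^2, and what remains is a constant.\<close>
    have null: "form f q = 0" if "lowdeg N f" for N f
      using that
    proof (induction N arbitrary: f)
      case 0
      then have "f = (\<lambda>a. 0)" by (auto simp: lowdeg_def fun_eq_iff poly_eq_iff)
      then show ?case by simp
    next
      case (Suc N)
      let ?f = "\<lambda>a. poly_shift 1 (f a)"
      have "lowdeg N ?f" using Suc.prems by (simp add: lowdeg_def coeff_poly_shift)
      then have "form (\<lambda>a. pCons 0 (?f a)) q = 0"
        using Suc.IH by (simp add: form_pCons_0 X)
      moreover have "f = (\<lambda>a. [:coeff (f a) 0:] + pCons 0 (?f a))"
        by (auto simp: fun_eq_iff poly_eq_iff coeff_poly_shift coeff_pCons split: nat.split)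
      then have "form f q = form (\<lambda>a. [:coeff (f a) 0:]) q + form (\<lambda>a. pCons 0 (?f a)) q"
        by (metis form_add_left)
      ultimately show ?case using const by simp
    qed
    have "form q q = 0" by (rule null[of m]) (simp add: q_def lowdeg_st)
    then show False using h0 by simp
  qed
  then show ?thesis unfolding hurwitz_def by (meson not_le)
qed

text \<open>Two factors W are distributed over the two arguments. W f may have degree m, so it is
  reduced by columns of \<open>E\<close> to an equivalent \<open>r\<close> of low degree, to which
  positivity for t applies.\<close>

lemma hankel_pos_Suc_Suc:
  assumes pos: "hankel_pos t" and pos1: "hankel_pos 1"
  shows "hankel_pos (Suc (Suc t))"
  unfolding hankel_pos_def
proof (intro allI impI, elim conjE)
  fix f assume f: "lowdeg m f" "\<exists>a<p. f a \<noteq> 0"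
  obtain v where v: "\<And>a. a < p \<Longrightarrow> (\<Sum>c<p. coeff (E a c) m * v c) = coeff (pCons 0 (f a)) m"
    using regular_solve[OF regular_E, of "\<lambda>a. coeff (pCons 0 (f a)) m"] by blast
  \<comment> \<open>\<open>v\<close> cancels the coefficient of degree m only for a < p; the default
    0 gives \<open>lowdeg\<close>, which speaks of all indices.\<close>
  define r where "r a = (if a < p then pCons 0 (f a) - (\<Sum>c<p. smult (v c) (E a c)) else 0)" for a
  have r: "lowdeg m r"
    unfolding lowdeg_def
  proof (intro allI impI)
    fix a i assume "m \<le> i"
    show "coeff (r a) i = 0"
    proof (cases "i = m")
      case True
      then show ?thesis using v by (simp add: r_def coeff_sum mult.commute)
    next
      case False
      then have "coeff (E a c) i = 0" for c
        using degree_E[of a c] \<open>m \<le> i\<close> by (intro coeff_eq_0) linarith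
      moreover have "coeff (pCons 0 (f a)) i = 0"
        using f(1) \<open>m \<le> i\<close> False by (cases i) (simp_all add: lowdeg_def)
      ultimately show ?thesis by (simp add: r_def coeff_sum)
    qed
  qed
  have right: "form g r = form g (\<lambda>a. pCons 0 (f a))" for g
  proof -
    have "form g r = form g (\<lambda>a. pCons 0 (f a) - (\<Sum>c<p. smult (v c) (E a c)))"
      by (rule form_cong) (simp_all add: r_def)
    then show ?thesis by (simp add: form_diff_right form_E_right)
  qed
  then have left: "form r g = form (\<lambda>a. pCons 0 (f a)) g" for g
    by (subst (1 2) form_herm) simp
  \<comment> \<open>If r were 0, the form of f with W f would vanish, against the strict sign in
    \<open>hankel_pos 1\<close>.\<close>
  have "\<exists>a<p. r a \<noteq> 0"
  proof (rule ccontr)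
    assume "\<not> ?thesis"
    then have "form f r = 0" using form_cong[of f f r "\<lambda>a. 0"] by simp
    then show False using pos1 f unfolding hankel_pos_1 right by force
  qed
  then have "0 < Re ((- 1) ^ t * form r (\<lambda>a. monom 1 t * r a))"
    using pos r by (simp add: hankel_pos_def)
  also have "form r (\<lambda>a. monom 1 t * r a) = form f (\<lambda>a. monom 1 (Suc (Suc t)) * f a)"
  proof -
    let ?f = "\<lambda>a. pCons 0 (f a)"
    have "form r (\<lambda>a. monom 1 t * r a) = form (\<lambda>a. monom 1 t * ?f a) r"
      unfolding left by (rule form_monom)
    also have "\<dots> = form (\<lambda>a. monom 1 t * ?f a) ?f"
      by (rule right)
    also have "\<dots> = form ?f (\<lambda>a. monom 1 t * ?f a)"
      by (rule form_monom[symmetric])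
    also have "\<dots> = form f (\<lambda>a. pCons 0 (monom 1 t * ?f a))"
      by (rule form_pCons_0)
    finally show ?thesis by (simp add: monom_Suc)
  qed
  finally show "0 < Re ((- 1) ^ Suc (Suc t) * form f (\<lambda>a. monom 1 (Suc (Suc t)) * f a))"
    by simp
qed

text \<open>The three arguments of the energy are independent, so setting two of them to 0 isolates
  positivity for t = 0, for t = 1 and for \<open>C\<close>; larger t follow in steps of two.\<close>

theorem hurwitz_iff:
  "hurwitz \<longleftrightarrow> (\<forall>t. hankel_pos t) \<and> (n = 2 * m + 1 \<longrightarrow>
    (\<forall>v. (\<exists>c<p. v c \<noteq> 0) \<longrightarrow> 0 < Re (\<Sum>a<p. \<Sum>b<p. cnj (v a) * C a b * v b)))"
proof
  assume hurwitz
  have low0: "lowdeg m (\<lambda>a. 0)" by (simp add: lowdeg_def)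
  have 0: "hankel_pos 0"
    unfolding hankel_pos_0 using hurwitz_imp_energy_pos[OF \<open>hurwitz\<close> low0, of _ "\<lambda>a. 0"] by simp
  have 1: "hankel_pos 1"
    unfolding hankel_pos_1 using hurwitz_imp_energy_pos[OF \<open>hurwitz\<close> _ low0, of _ "\<lambda>a. 0"] by simp
  have "hankel_pos t \<and> hankel_pos (Suc t)" for t
    by (induction t) (use 0 1 hankel_pos_Suc_Suc in auto)
  then show "(\<forall>t. hankel_pos t) \<and> (n = 2 * m + 1 \<longrightarrow>
    (\<forall>v. (\<exists>c<p. v c \<noteq> 0) \<longrightarrow> 0 < Re (\<Sum>a<p. \<Sum>b<p. cnj (v a) * C a b * v b)))"
    using hurwitz_imp_energy_pos[OF \<open>hurwitz\<close> low0 low0] by simp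
next
  assume "(\<forall>t. hankel_pos t) \<and> (n = 2 * m + 1 \<longrightarrow>
    (\<forall>v. (\<exists>c<p. v c \<noteq> 0) \<longrightarrow> 0 < Re (\<Sum>a<p. \<Sum>b<p. cnj (v a) * C a b * v b)))"
  then show hurwitz by (intro hurwitz_of_pos) auto
qed

end

section \<open>Schur complements\<close>

definition sesq :: "nat \<Rightarrow> (nat \<Rightarrow> nat \<Rightarrow> complex) \<Rightarrow> (nat \<Rightarrow> complex) \<Rightarrow> (nat \<Rightarrow> complex) \<Rightarrow> complex" where
  "sesq N M u v = (\<Sum>r<N. \<Sum>c<N. cnj (u r) * M r c * v c)"

text \<open>Unlike \<open>pos_def_mat\<close>, this leaves Hermitian symmetry apart; it is carried
  by separate hypotheses.\<close>

definition pos_def_on :: "nat \<Rightarrow> (nat \<Rightarrow> nat \<Rightarrow> complex) \<Rightarrow> bool" where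
  "pos_def_on N M \<longleftrightarrow> (\<forall>v. (\<exists>r<N. v r \<noteq> 0) \<longrightarrow> 0 < Re (sesq N M v v))"

lemma pos_def_onD: "pos_def_on N M \<Longrightarrow> r < N \<Longrightarrow> v r \<noteq> 0 \<Longrightarrow> 0 < Re (sesq N M v v)"
  unfolding pos_def_on_def by auto

lemma pos_def_on_nonneg: "pos_def_on N M \<Longrightarrow> 0 \<le> Re (sesq N M v v)"
proof (cases "\<exists>r<N. v r \<noteq> 0")
  case True
  assume "pos_def_on N M"
  with True show ?thesis by (auto intro: less_imp_le[OF pos_def_onD])
next
  case False
  then show ?thesis by (simp add: sesq_def)
qed

lemma sesq_cong: "(\<And>r. r < N \<Longrightarrow> u r = u' r) \<Longrightarrow> (\<And>r. r < N \<Longrightarrow> v r = v' r) \<Longrightarrow> sesq N M u v = sesq N M u' v'"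
  by (simp add: sesq_def)

lemma sesq_add_right: "sesq N M u (\<lambda>r. v r + w r) = sesq N M u v + sesq N M u w"
  by (simp add: sesq_def algebra_simps sum.distrib)

lemma sesq_add_left: "sesq N M (\<lambda>r. v r + w r) u = sesq N M v u + sesq N M w u"
  by (simp add: sesq_def algebra_simps sum.distrib)

lemma sesq_herm:
  assumes "\<And>r c. r < N \<Longrightarrow> c < N \<Longrightarrow> M r c = cnj (M c r)"
  shows "cnj (sesq N M u v) = sesq N M v u"
proof -
  have "cnj (sesq N M u v) = (\<Sum>r<N. \<Sum>c<N. cnj (v c) * M c r * u r)"
    unfolding sesq_def cnj_sum
  proof (intro sum.cong refl)
    fix r c assume "r \<in> {..<N}" "c \<in> {..<N}"
    then have "cnj (M r c) = M c r" using assms[of c r] by simp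
    then show "cnj (cnj (u r) * M r c * v c) = cnj (v c) * M c r * u r"
      by (simp add: mult_ac)
  qed
  also have "\<dots> = sesq N M v u" unfolding sesq_def by (rule sum.swap)
  finally show ?thesis .
qed

lemma sum_lessThan_add: "(\<Sum>r<q + p. f r) = (\<Sum>r<q. f r) + (\<Sum>i<p. f (q + i :: nat) :: complex)"
  by (induction p) (simp_all add: add.assoc)

text \<open>Completing the square: \<open>W\<close> is the solution of \<open>L W = B\<close> for the leading block \<open>L\<close> and
  the block \<open>B\<close> next to it, and \<open>S\<close> is the Schur complement.\<close>

locale schur_complement =
  fixes q p :: nat and M :: "nat \<Rightarrow> nat \<Rightarrow> complex" and W S :: "nat \<Rightarrow> nat \<Rightarrow> complex"
  assumes hermM: "r < q + p \<Longrightarrow> c < q + p \<Longrightarrow> M r c = cnj (M c r)"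
    and W: "r < q \<Longrightarrow> j < p \<Longrightarrow> (\<Sum>c<q. M r c * W c j) = M r (q + j)"
    and S: "i < p \<Longrightarrow> j < p \<Longrightarrow> S i j = M (q + i) (q + j) - (\<Sum>r<q. M (q + i) r * W r j)"
begin

lemma lead_herm: "r < q \<Longrightarrow> c < q \<Longrightarrow> M r c = cnj (M c r)"
  by (rule hermM) simp_all

lemma sesq_W:
  assumes "\<And>r. r < q \<Longrightarrow> w r = (\<Sum>j<p. W r j * x j)"
  shows "sesq q M u w = (\<Sum>r<q. \<Sum>j<p. cnj (u r) * M r (q + j) * x j)"
proof -
  have "(\<Sum>c<q. M r c * w c) = (\<Sum>j<p. M r (q + j) * x j)" if "r < q" for r
  proof -
    have "(\<Sum>c<q. M r c * w c) = (\<Sum>c<q. \<Sum>j<p. M r c * W c j * x j)"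
      using assms by (simp add: sum_distrib_left mult.assoc)
    also have "\<dots> = (\<Sum>j<p. (\<Sum>c<q. M r c * W c j) * x j)"
      by (subst sum.swap) (simp only: sum_distrib_right)
    finally show ?thesis using W[OF that] by simp
  qed
  then have "sesq q M u w = (\<Sum>r<q. cnj (u r) * (\<Sum>j<p. M r (q + j) * x j))"
    by (simp add: sesq_def mult.assoc flip: sum_distrib_left)
  then show ?thesis by (simp add: sum_distrib_left mult.assoc)
qed

lemma complete_square:
  defines "w \<equiv> \<lambda>v r. \<Sum>j<p. W r j * v (q + j)"
  shows "sesq (q + p) M v v =
    sesq q M (\<lambda>r. v r + w v r) (\<lambda>r. v r + w v r) + sesq p S (\<lambda>i. v (q + i)) (\<lambda>i. v (q + i))"
proof -
  let ?x = "\<lambda>i. v (q + i)"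
  have right: "sesq q M u (w v) = (\<Sum>r<q. \<Sum>j<p. cnj (u r) * M r (q + j) * ?x j)" for u
    by (rule sesq_W) (simp add: w_def)
  have left: "sesq q M (w v) u = (\<Sum>j<p. \<Sum>r<q. cnj (?x j) * M (q + j) r * u r)" for u
  proof -
    have "sesq q M (w v) u = cnj (sesq q M u (w v))"
      using sesq_herm[OF lead_herm] by simp
    also have "\<dots> = (\<Sum>r<q. \<Sum>j<p. cnj (?x j) * M (q + j) r * u r)"
      unfolding right cnj_sum
    proof (intro sum.cong refl)
      fix r j assume "r \<in> {..<q}" "j \<in> {..<p}"
      then have "cnj (M r (q + j)) = M (q + j) r" using hermM[of "q + j" r] by simp
      then show "cnj (cnj (u r) * M r (q + j) * ?x j) = cnj (?x j) * M (q + j) r * u r"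
        by (simp add: mult_ac)
    qed
    finally show ?thesis by (subst (asm) sum.swap)
  qed
  have S': "sesq p S ?x ?x = (\<Sum>i<p. \<Sum>j<p. cnj (?x i) * M (q + i) (q + j) * ?x j) - sesq q M (w v) (w v)"
  proof -
    have "(\<Sum>i<p. \<Sum>j<p. cnj (?x i) * (\<Sum>r<q. M (q + i) r * W r j) * ?x j) = sesq q M (w v) (w v)"
    proof -
      have "(\<Sum>i<p. \<Sum>j<p. cnj (?x i) * (\<Sum>r<q. M (q + i) r * W r j) * ?x j)
        = (\<Sum>i<p. \<Sum>j<p. \<Sum>r<q. cnj (?x i) * M (q + i) r * (W r j * ?x j))"
        by (simp add: sum_distrib_left sum_distrib_right mult.assoc)
      also have "\<dots> = (\<Sum>i<p. \<Sum>r<q. \<Sum>j<p. cnj (?x i) * M (q + i) r * (W r j * ?x j))"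
        by (intro sum.cong refl sum.swap)
      also have "\<dots> = sesq q M (w v) (w v)"
        unfolding left by (simp add: w_def sum_distrib_left)
      finally show ?thesis .
    qed
    then show ?thesis
      by (simp add: sesq_def S algebra_simps sum_subtractf)
  qed
  have "sesq (q + p) M v v = sesq q M v v + (\<Sum>r<q. \<Sum>j<p. cnj (v r) * M r (q + j) * ?x j)
     + (\<Sum>i<p. \<Sum>r<q. cnj (?x i) * M (q + i) r * v r)
     + (\<Sum>i<p. \<Sum>j<p. cnj (?x i) * M (q + i) (q + j) * ?x j)"
    by (simp add: sesq_def sum_lessThan_add sum.distrib)
  then show ?thesis
    unfolding right[symmetric] left[symmetric] S'
    by (simp add: sesq_add_left sesq_add_right)
qed

text \<open>The subtracted product equals W* L W with the Hermitian leading block L.\<close>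

lemma S_herm:
  assumes "i < p" "j < p" shows "S i j = cnj (S j i)"
proof -
  have *: "S i j = M (q + i) (q + j) - sesq q M (\<lambda>r. W r i) (\<lambda>r. W r j)" if "i < p" "j < p" for i j
  proof -
    have "sesq q M (\<lambda>r. W r i) (\<lambda>r. W r j) = (\<Sum>c<q. (\<Sum>r<q. cnj (W r i) * M r c) * W c j)"
      unfolding sesq_def by (subst sum.swap) (simp only: sum_distrib_right)
    also have "\<dots> = (\<Sum>c<q. M (q + i) c * W c j)"
    proof (intro sum.cong refl)
      fix c assume c: "c \<in> {..<q}"
      have "(\<Sum>r<q. cnj (W r i) * M r c) = cnj (\<Sum>r<q. M c r * W r i)"
        unfolding cnj_sum
      proof (intro sum.cong refl)
        fix r assume "r \<in> {..<q}"
        then have "cnj (M c r) = M r c" using c lead_herm[of r c] by simp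
        then show "cnj (W r i) * M r c = cnj (M c r * W r i)" by (simp add: mult.commute)
      qed
      also have "\<dots> = M (q + i) c"
        using c that W[of c i] hermM[of "q + i" c] by simp
      finally show "(\<Sum>r<q. cnj (W r i) * M r c) * W c j = M (q + i) c * W c j" by simp
    qed
    finally show ?thesis using S that by simp
  qed
  have "M (q + i) (q + j) = cnj (M (q + j) (q + i))"
    using assms by (intro hermM) simp_all
  moreover have "sesq q M (\<lambda>r. W r i) (\<lambda>r. W r j) = cnj (sesq q M (\<lambda>r. W r j) (\<lambda>r. W r i))"
    by (rule sesq_herm[OF lead_herm, symmetric])
  ultimately show ?thesis
    by (simp only: *[OF assms] *[OF assms(2,1)] complex_cnj_diff)
qed

lemma pos_def_on_iff:
  assumes "pos_def_on q M"
  shows "pos_def_on (q + p) M \<longleftrightarrow> pos_def_on p S"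
proof
  assume pos: "pos_def_on (q + p) M"
  show "pos_def_on p S"
    unfolding pos_def_on_def
  proof (intro allI impI)
    fix x :: "nat \<Rightarrow> complex" assume x: "\<exists>i<p. x i \<noteq> 0"
    \<comment> \<open>The first q entries are chosen so that the square over the leading block in
      \<open>complete_square\<close> vanishes.\<close>
    let ?v = "\<lambda>r. if r < q then - (\<Sum>j<p. W r j * x j) else x (r - q)"
    obtain i where "i < p" "x i \<noteq> 0" using x by blast
    then have "\<exists>r<q + p. ?v r \<noteq> 0"
      by (intro exI[of _ "q + i"]) simp
    then have "0 < Re (sesq (q + p) M ?v ?v)" using pos by (simp only: pos_def_on_def)
    also have "sesq (q + p) M ?v ?v = sesq q M (\<lambda>r. 0) (\<lambda>r. 0) + sesq p S x x"
      unfolding complete_square by (intro arg_cong2[of _ _ _ _ "(+)"] sesq_cong) simp_all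
    finally show "0 < Re (sesq p S x x)" by (simp add: sesq_def)
  qed
next
  assume pos: "pos_def_on p S"
  show "pos_def_on (q + p) M"
    unfolding pos_def_on_def
  proof (intro allI impI)
    fix v :: "nat \<Rightarrow> complex" assume "\<exists>r<q + p. v r \<noteq> 0"
    then obtain r where r: "r < q + p" "v r \<noteq> 0" by blast
    define x where "x i = v (q + i)" for i
    define u where "u r = v r + (\<Sum>j<p. W r j * v (q + j))" for r
    have eq: "sesq (q + p) M v v = sesq q M u u + sesq p S x x"
      unfolding complete_square u_def x_def ..
    have nonneg: "0 \<le> Re (sesq q M u u)" "0 \<le> Re (sesq p S x x)"
      using assms pos by (auto intro: pos_def_on_nonneg)
    show "0 < Re (sesq (q + p) M v v)"
    proof (cases "\<exists>i<p. x i \<noteq> 0")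
      case True
      then obtain i where "i < p" "x i \<noteq> 0" by blast
      then have "0 < Re (sesq p S x x)" by (rule pos_def_onD[OF pos])
      then show ?thesis using nonneg by (simp add: eq)
    next
      case False
      then have "r < q" using r le_add_diff_inverse[of q r] unfolding x_def
        by (metis add_less_cancel_left not_le)
      moreover have "u r = v r" using False by (simp add: u_def x_def)
      ultimately have "0 < Re (sesq q M u u)" using r(2) by (intro pos_def_onD[OF assms]) auto
      then show ?thesis using nonneg by (simp add: eq)
    qed
  qed
qed

end

section \<open>From Schur complements to quasiminors\<close>

lemma pos_def_on_det:
  assumes "pos_def_on q M" shows "det (mat q q (\<lambda>(r, c). M r c)) \<noteq> 0"
proof
  assume "det (mat q q (\<lambda>(r, c). M r c)) = 0"
  then obtain v where v: "\<exists>c<q. v c \<noteq> 0" "\<And>r. r < q \<Longrightarrow> (\<Sum>c<q. M r c * v c) = 0"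
    unfolding singular_null_vector by blast
  have "sesq q M v v = (\<Sum>r<q. cnj (v r) * (\<Sum>c<q. M r c * v c))"
    by (simp add: sesq_def sum_distrib_left mult.assoc)
  also have "\<dots> = 0" using v(2) by simp
  finally show False using assms v(1) unfolding pos_def_on_def by fastforce
qed

lemma pos_def_on_mono:
  assumes "pos_def_on (q + p) M" shows "pos_def_on q M"
  unfolding pos_def_on_def
proof (intro allI impI)
  fix v :: "nat \<Rightarrow> complex" assume v: "\<exists>r<q. v r \<noteq> 0"
  let ?v = "\<lambda>r. if r < q then v r else 0"
  have "\<exists>r<q + p. ?v r \<noteq> 0" using v by (auto intro: less_le_trans)
  then have "0 < Re (sesq (q + p) M ?v ?v)" using assms by (simp only: pos_def_on_def)
  also have "sesq (q + p) M ?v ?v = sesq q M v v"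
    by (simp add: sesq_def sum_lessThan_add)
  finally show "0 < Re (sesq q M v v)" .
qed

lemma pos_def_mat_iff:
  assumes "Q \<in> carrier_mat p p"
  shows "pos_def_mat Q \<longleftrightarrow> (\<forall>i<p. \<forall>j<p. Q $$ (i, j) = cnj (Q $$ (j, i))) \<and>
    pos_def_on p (\<lambda>i j. Q $$ (i, j))"
proof -
  have dim: "dim_row Q = p" "dim_col Q = p" using assms by auto
  have val: "(\<Sum>i<p. cnj (v $ i) * (Q *\<^sub>v v) $ i) = sesq p (\<lambda>i j. Q $$ (i, j)) (\<lambda>i. v $ i) (\<lambda>i. v $ i)"
    if "v \<in> carrier_vec p" for v
  proof -
    have "(Q *\<^sub>v v) $ i = (\<Sum>j<p. Q $$ (i, j) * v $ j)" if "i < p" for i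
      using dim \<open>v \<in> carrier_vec p\<close> that
      by (auto simp: scalar_prod_def atLeast0LessThan intro!: sum.cong)
    then show ?thesis by (simp add: sesq_def sum_distrib_left mult.assoc)
  qed
  have "(\<forall>v. v \<in> carrier_vec p \<and> v \<noteq> 0\<^sub>v p \<longrightarrow> 0 < Re (\<Sum>i<p. cnj (v $ i) * (Q *\<^sub>v v) $ i))
    \<longleftrightarrow> pos_def_on p (\<lambda>i j. Q $$ (i, j))" (is "?L \<longleftrightarrow> ?R")
  proof
    assume L: ?L
    show ?R
      unfolding pos_def_on_def
    proof (intro allI impI)
      fix v :: "nat \<Rightarrow> complex" assume "\<exists>r<p. v r \<noteq> 0"
      then have "vec p v \<noteq> 0\<^sub>v p" by (metis index_vec index_zero_vec(1))
      then have "0 < Re (\<Sum>i<p. cnj (vec p v $ i) * (Q *\<^sub>v vec p v) $ i)"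
        using L[rule_format, of "vec p v"] by simp
      also have "(\<Sum>i<p. cnj (vec p v $ i) * (Q *\<^sub>v vec p v) $ i) = sesq p (\<lambda>i j. Q $$ (i, j)) v v"
        by (subst val) (auto intro: sesq_cong)
      finally show "0 < Re (sesq p (\<lambda>i j. Q $$ (i, j)) v v)" .
    qed
  next
    assume R: ?R
    show ?L
    proof (intro allI impI, elim conjE)
      fix v :: "complex vec" assume v: "v \<in> carrier_vec p" "v \<noteq> 0\<^sub>v p"
      then have "\<exists>r<p. v $ r \<noteq> 0" by (metis carrier_vecD eq_vecI index_zero_vec)
      then show "0 < Re (\<Sum>i<p. cnj (v $ i) * (Q *\<^sub>v v) $ i)"
        using R unfolding val[OF v(1)] pos_def_on_def by blast
    qed
  qed
  then show ?thesis unfolding pos_def_mat_def hermitian_mat_def dim by auto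
qed

text \<open>A block form of Sylvester's criterion: each block row and column added contributes its
  Schur complement, the quasiminor. Positivity of the smaller quasiminors makes the leading block
  positive definite, hence nonsingular, so the next quasiminor is well defined.\<close>

lemma pos_def_on_quasiminors:
  fixes M :: "nat \<Rightarrow> nat \<Rightarrow> complex"
  assumes herm: "\<And>r c. M r c = cnj (M c r)"
    and Ml: "\<And>l. Ml l = mat (l * p) (l * p) (\<lambda>(r, c). M r c)"
  shows "pos_def_on (m * p) M \<longleftrightarrow>
    (\<forall>l. 1 \<le> l \<and> l \<le> m \<longrightarrow> det (bh_lead p l (Ml l)) \<noteq> 0 \<and> pos_def_mat (quasiminor p l (Ml l)))"
proof (induction m)
  case 0
  then show ?case by (simp add: pos_def_on_def)
next
  case (Suc k)
  let ?q = "k * p" and ?l = "Suc k"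
  let ?L = "mat ?q ?q (\<lambda>(r, c). M r c)"
  have lead: "bh_lead p ?l (Ml ?l) = ?L"
    unfolding bh_lead_def Ml by (rule eq_matI) auto
  have step: "pos_def_on (?q + p) M \<longleftrightarrow> pos_def_mat (quasiminor p ?l (Ml ?l))"
    if pos: "pos_def_on ?q M"
  proof -
    have det: "det ?L \<noteq> 0" using pos by (rule pos_def_on_det)
    let ?K = "minv ?L"
    have L: "?L \<in> carrier_mat ?q ?q" by simp
    have K: "?K \<in> carrier_mat ?q ?q" using adj_mat(1)[OF L] by (simp add: minv_def)
    have LK: "?L * ?K = 1\<^sub>m ?q"
      unfolding minv_def using det adj_mat(1,2)[OF L]
      by (subst mult_smult_distrib[OF L]) (auto intro!: eq_matI)
    define B where "B = mat ?q p (\<lambda>(r, c). M r (?q + c))"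
    have B: "B \<in> carrier_mat ?q p" by (simp add: B_def)
    define X where "X = ?K * B"
    have X: "X \<in> carrier_mat ?q p" using K B by (simp add: X_def)
    have "?L * X = ?L * ?K * B" unfolding X_def by (rule assoc_mult_mat[OF L K B, symmetric])
    also have "\<dots> = B" unfolding LK using B by simp
    finally have LX: "?L * X = B" .
    define W where "W r j = X $$ (r, j)" for r j
    define S where "S i j = M (?q + i) (?q + j) - (\<Sum>r<?q. M (?q + i) r * W r j)" for i j
    have "schur_complement ?q p M W S"
    proof
      show "M r c = cnj (M c r)" for r c by (rule herm)
      show "S i j = M (?q + i) (?q + j) - (\<Sum>r<?q. M (?q + i) r * W r j)" for i j
        by (simp add: S_def)
      fix r j assume rj: "r < ?q" "j < p"
      have "(?L * X) $$ (r, j) = (\<Sum>c<?q. M r c * W c j)"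
        using rj X by (auto simp: W_def scalar_prod_def atLeast0LessThan intro!: sum.cong)
      then show "(\<Sum>c<?q. M r c * W c j) = M r (?q + j)"
        unfolding LX using rj by (simp add: B_def)
    qed
    then interpret schur_complement ?q p M W S .
    have Q: "quasiminor p ?l (Ml ?l) = mat p p (\<lambda>(i, j). S i j)"
    proof -
      let ?C = "mat p ?q (\<lambda>(r, c). M (?q + r) c)" and ?D = "mat p p (\<lambda>(r, c). M (?q + r) (?q + c))"
      have "mat ?q p (\<lambda>(r, c). Ml ?l $$ (r, ?q + c)) = B"
        "mat p ?q (\<lambda>(r, c). Ml ?l $$ (?q + r, c)) = ?C"
        "mat p p (\<lambda>(r, c). Ml ?l $$ (?q + r, ?q + c)) = ?D"
        by (auto simp: Ml B_def intro!: eq_matI)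
      moreover have CKB: "?C * ?K * B = ?C * X"
        unfolding X_def using K B by (intro assoc_mult_mat[of _ p ?q _ ?q _ p]) auto
      ultimately have "quasiminor p ?l (Ml ?l) = ?D - ?C * X"
        unfolding quasiminor_def Let_def lead CKB[symmetric] by simp
      also have "?D - ?C * X = mat p p (\<lambda>(i, j). S i j)"
      proof (rule eq_matI)
        fix i j assume "i < dim_row (mat p p (\<lambda>(i, j). S i j))" "j < dim_col (mat p p (\<lambda>(i, j). S i j))"
        then have ij: "i < p" "j < p" by auto
        have "(?C * X) $$ (i, j) = (\<Sum>r<?q. M (?q + i) r * W r j)"
          using ij X by (auto simp: W_def scalar_prod_def atLeast0LessThan intro!: sum.cong)
        then show "(?D - ?C * X) $$ (i, j) = mat p p (\<lambda>(i, j). S i j) $$ (i, j)"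
          using ij X by (simp add: S_def)
      qed (use X in auto)
      finally show ?thesis .
    qed
    let ?Q = "mat p p (\<lambda>(i, j). S i j)"
    have "?Q $$ (i, j) = cnj (?Q $$ (j, i))" if "i < p" "j < p" for i j
    proof -
      have "S i j = cnj (S j i)" using that by (rule S_herm)
      then show ?thesis using that by simp
    qed
    moreover have "?Q \<in> carrier_mat p p" by simp
    ultimately have "pos_def_mat ?Q \<longleftrightarrow> pos_def_on p (\<lambda>i j. ?Q $$ (i, j))"
      using pos_def_mat_iff[of ?Q p] by blast
    also have "\<dots> \<longleftrightarrow> pos_def_on p S"
      by (simp add: pos_def_on_def sesq_def)
    finally show ?thesis unfolding Q using pos_def_on_iff[OF pos] by simp
  qed
  have "pos_def_on (?l * p) M \<longleftrightarrow> pos_def_on ?q M \<and> pos_def_on (?q + p) M"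
    using pos_def_on_mono[of ?q p M] by (auto simp: add.commute)
  also have "\<dots> \<longleftrightarrow> pos_def_on ?q M \<and>
      det (bh_lead p ?l (Ml ?l)) \<noteq> 0 \<and> pos_def_mat (quasiminor p ?l (Ml ?l))"
    using step pos_def_on_det[of ?q M] unfolding lead by auto
  finally show ?case unfolding Suc.IH by (auto simp: le_Suc_eq)
qed

section \<open>Markov parameters and block Hankel matrices\<close>

text \<open>The disc is punctured because x will be 1 / z. Once the earlier coefficients vanish,
  dividing by x^n and letting x tend to 0 isolates \<open>a n\<close>.\<close>

lemma powser_eq_0_coeff:
  fixes a :: "nat \<Rightarrow> complex"
  assumes r: "0 < r" and sums: "\<And>x. x \<noteq> 0 \<Longrightarrow> norm x < r \<Longrightarrow> (\<lambda>n. a n * x ^ n) sums 0"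
  shows "a n = 0"
proof (induction n rule: less_induct)
  case (less n)
  have "(\<lambda>k. a (k + n) * x ^ k) sums 0" if x: "x \<noteq> 0" "norm x < r" for x
  proof -
    have "(\<Sum>i<n. a i * x ^ i) = 0" using less by simp
    then have "(\<lambda>k. a (k + n) * x ^ (k + n)) sums 0"
      using sums[OF x] by (subst sums_iff_shift) simp
    then have "(\<lambda>k. (1 / x ^ n) * (a (k + n) * x ^ (k + n))) sums ((1 / x ^ n) * 0)"
      by (rule sums_mult)
    also have "(\<lambda>k. (1 / x ^ n) * (a (k + n) * x ^ (k + n))) = (\<lambda>k. a (k + n) * x ^ k)"
      using x(1) by (simp add: power_add fun_eq_iff)
    finally show ?thesis by simp
  qed
  then have "((\<lambda>x :: complex. 0 :: complex) \<longlongrightarrow> a n) (at 0)"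
    using powser_limit_0_strong[of r "\<lambda>k. a (k + n)" "\<lambda>x. 0"] r by simp
  from LIM_const_eq[OF this] show ?case by simp
qed

lemma laurent_tail_eq_poly:
  fixes q :: "complex poly"
  assumes sums: "\<And>z. R < norm z \<Longrightarrow> (\<lambda>k. t k / z ^ (k + 1)) sums poly q z"
  shows "t k = 0" and "q = 0"
proof -
  define N where "N = degree q"
  \<comment> \<open>After multiplication by x^N with x = 1 / z, polynomial and tail become one power
    series in x: the coefficients of q in reverse order, then those of -t.\<close>
  define h where "h k = (if k \<le> N then coeff q (N - k) else - t (k - Suc N))" for k
  have h: "h k = 0" for k
  proof (rule powser_eq_0_coeff[of "1 / (\<bar>R\<bar> + 1)"])
    fix x :: complex assume x: "x \<noteq> 0" "norm x < 1 / (\<bar>R\<bar> + 1)"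
    have "\<bar>R\<bar> + 1 < 1 / norm x" using x by (simp add: field_simps)
    then have "R < norm (1 / x)" by (simp add: norm_divide)
    then have "(\<lambda>k. - (x ^ N) * (t k / (1 / x) ^ (k + 1))) sums (- (x ^ N) * poly q (1 / x))"
      by (intro sums_mult sums)
    also have "(\<lambda>k. - (x ^ N) * (t k / (1 / x) ^ (k + 1))) = (\<lambda>k. h (k + Suc N) * x ^ (k + Suc N))"
      using x(1) by (simp add: fun_eq_iff h_def power_add field_simps)
    also have "- (x ^ N) * poly q (1 / x) = 0 - (\<Sum>i<Suc N. h i * x ^ i)"
    proof -
      have "(\<Sum>i<Suc N. h i * x ^ i) = (\<Sum>i\<le>N. coeff q (N - i) * x ^ i)"
        by (simp add: h_def lessThan_Suc_atMost)
      also have "\<dots> = (\<Sum>j\<le>N. coeff q j * x ^ (N - j))"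
        by (rule sum.reindex_bij_witness[of _ "\<lambda>i. N - i" "\<lambda>i. N - i"]) auto
      also have "\<dots> = (\<Sum>j\<le>N. x ^ N * (coeff q j * (1 / x) ^ j))"
        using x(1) by (intro sum.cong refl) (simp add: power_diff power_one_over divide_simps)
      also have "\<dots> = x ^ N * poly q (1 / x)"
        by (simp add: poly_altdef N_def sum_distrib_left)
      finally show ?thesis by simp
    qed
    finally show "(\<lambda>n. h n * x ^ n) sums 0"
      by (subst (asm) sums_iff_shift) simp
  qed simp
  show "t k = 0" using h[of "k + Suc N"] by (simp add: h_def)
  have "coeff q i = 0" for i
  proof (cases "i \<le> N")
    case True
    then show ?thesis using h[of "N - i"] by (simp add: h_def)
  next
    case False
    then show ?thesis by (simp add: N_def coeff_eq_0)
  qed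
  then show "q = 0" by (simp add: poly_eq_iff)
qed

text \<open>Multiplying a Laurent series at infinity by e(z) gives nonnegative powers, collected in
  \<open>dquot e x\<close>, and negative powers, whose coefficients are e(shift) x.\<close>

lemma sums_pact:
  fixes x :: "nat \<Rightarrow> complex"
  assumes x: "(\<lambda>k. x k / z ^ (k + 1)) sums g" and z: "z \<noteq> 0"
  shows "(\<lambda>k. pact e x k / z ^ (k + 1)) sums (g * poly e z - poly (dquot e x) z)"
proof (induction e)
  case 0
  then show ?case by simp
next
  case (pCons c e)
  have "(\<lambda>k. pact e x (k + 1) / z ^ (k + 1 + 1)) sums
      (g * poly e z - poly (dquot e x) z - (\<Sum>i<1. pact e x i / z ^ (i + 1)))"
    using pCons.IH by (subst sums_iff_shift) simp
  then have "(\<lambda>k. z * (pact e x (k + 1) / z ^ (k + 1 + 1))) sums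
      (z * (g * poly e z - poly (dquot e x) z - (\<Sum>i<1. pact e x i / z ^ (i + 1))))"
    by (rule sums_mult)
  from sums_add[OF sums_mult[OF x, of c] this] show ?case
    using z by (simp add: pact_pCons dquot_pCons add_divide_distrib algebra_simps)
qed

section \<open>Rank of block Hankel matrices\<close>

lemma sum_lessThan_mult:
  fixes f :: "nat \<Rightarrow> 'a :: comm_monoid_add"
  shows "(\<Sum>r<m * p. f r) = (\<Sum>i<m. \<Sum>a<p. f (i * p + a))"
proof -
  have "sum f {i * p..<i * p + p} = (\<Sum>a<p. f (i * p + a))" for i
    using sum.shift_bounds_nat_ivl[of f 0 "i * p" p] by (simp add: atLeast0LessThan add.commute)
  then show ?thesis by (simp add: sum.nat_group[symmetric])
qed

text \<open>The hypothesis factors the matrix through dimension m p, which is less than its size l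
  p.\<close>

lemma block_hankel_det_eq_0:
  fixes X :: "nat \<Rightarrow> nat \<Rightarrow> nat \<Rightarrow> nat \<Rightarrow> complex"
  assumes X: "\<And>k i a b. a < p \<Longrightarrow> b < p \<Longrightarrow>
      s (i + k) $$ (a, b) = (\<Sum>t<m. \<Sum>c<p. s (i + t) $$ (a, c) * X k t c b)"
    and l: "m < l" and p: "1 \<le> p"
  shows "det (block_hankel p s l js ks) = 0"
proof -
  let ?n = "l * p"
  \<comment> \<open>Both factors are padded with zeros to square matrices so that
    \<open>det_mult\<close> applies; column m p of N is then zero.\<close>
  define N where "N r q = (if q < m * p then s (js (r div p) + q div p) $$ (r mod p, q mod p) else 0)" for r q
  define Y where "Y q c = (if q < m * p then X (ks (c div p)) (q div p) (q mod p) (c mod p) else 0)" for q c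
  have mp: "m * p < ?n" using l p by simp
  have "block_hankel p s l js ks = mat ?n ?n (\<lambda>(r, c). N r c) * mat ?n ?n (\<lambda>(r, c). Y r c)"
  proof (rule eq_matI)
    fix r c assume "r < dim_row (mat ?n ?n (\<lambda>(r, c). N r c) * mat ?n ?n (\<lambda>(r, c). Y r c))"
      "c < dim_col (mat ?n ?n (\<lambda>(r, c). N r c) * mat ?n ?n (\<lambda>(r, c). Y r c))"
    then have rc: "r < ?n" "c < ?n" by auto
    have "(mat ?n ?n (\<lambda>(r, c). N r c) * mat ?n ?n (\<lambda>(r, c). Y r c)) $$ (r, c) = (\<Sum>q<?n. N r q * Y q c)"
      using rc by (auto simp: scalar_prod_def atLeast0LessThan intro!: sum.cong)
    also have "\<dots> = (\<Sum>q<m * p. N r q * Y q c)"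
      by (rule sum.mono_neutral_right) (use mp in \<open>auto simp: N_def\<close>)
    also have "\<dots> = (\<Sum>t<m. \<Sum>d<p. N r (t * p + d) * Y (t * p + d) c)"
      by (rule sum_lessThan_mult)
    also have "\<dots> = (\<Sum>t<m. \<Sum>d<p. s (js (r div p) + t) $$ (r mod p, d) * X (ks (c div p)) t d (c mod p))"
    proof (intro sum.cong refl)
      fix t d assume "t \<in> {..<m}" "d \<in> {..<p}"
      then have "t * p + d < m * p"
        using mult_le_mono1[of "Suc t" m p] by simp
      then show "N r (t * p + d) * Y (t * p + d) c =
          s (js (r div p) + t) $$ (r mod p, d) * X (ks (c div p)) t d (c mod p)"
        using \<open>d \<in> {..<p}\<close> by (simp add: N_def Y_def)
    qed
    also have "\<dots> = s (js (r div p) + ks (c div p)) $$ (r mod p, c mod p)"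
      using p by (intro X[symmetric]) simp_all
    finally show "block_hankel p s l js ks $$ (r, c) =
        (mat ?n ?n (\<lambda>(r, c). N r c) * mat ?n ?n (\<lambda>(r, c). Y r c)) $$ (r, c)"
      using rc by (simp add: block_hankel_def)
  qed (simp_all add: block_hankel_def)
  moreover have "det (mat ?n ?n (\<lambda>(r, c). N r c)) = 0"
    unfolding singular_null_vector
  proof (intro exI[of _ "\<lambda>c. if c = m * p then 1 else 0"] conjI allI impI)
    show "\<exists>c<?n. (if c = m * p then 1 else 0) \<noteq> (0 :: complex)" using mp by auto
    fix r
    show "(\<Sum>c<?n. N r c * (if c = m * p then 1 else 0)) = 0"
      by (rule sum.neutral) (simp add: N_def)
  qed
  ultimately show ?thesis by (simp add: det_mult[of _ ?n])
qed

lemma pact_lowdeg: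
  assumes "\<And>i. N \<le> i \<Longrightarrow> coeff f i = 0"
  shows "pact f x k = (\<Sum>i<N. coeff f i * x (i + k))"
proof (cases "f = 0")
  case True
  then show ?thesis by simp
next
  case False
  then have "degree f < N" using assms[of "degree f"] by (meson leading_coeff_0_iff not_le)
  then show ?thesis
    unfolding pact_def by (intro sum.mono_neutral_left) (auto simp: coeff_eq_0)
qed

lemma pact_monom: "pact (monom c t) x k = c * x (k + t)"
  by (induction t arbitrary: k) (simp_all add: monom_0 monom_Suc pact_pCons)

context hankel_kernel
begin

text \<open>Inverting the leading coefficient of \<open>E\<close> in \<open>kernel\<close> gives a
  linear recurrence of order m. The coefficients X depend on the block column k but not on the row
  i, which makes them usable for arbitrary row selections.\<close>

lemma recurrence:
  assumes regular: "det (mat p p (\<lambda>(a, c). coeff (E a c) m)) \<noteq> 0"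
  shows "\<exists>X. \<forall>i a b. a < p \<and> b < p \<longrightarrow> \<sigma> a b (i + k) = (\<Sum>t<m. \<Sum>c<p. \<sigma> a c (i + t) * X t c b)"
proof (induction k rule: less_induct)
  case (less k)
  \<comment> \<open>The vectors \<open>y d\<close> are the columns of the inverse of the leading
    coefficient.\<close>
  have "\<forall>d. \<exists>y. \<forall>b<p. (\<Sum>c<p. coeff (E b c) m * y c) = (if b = d then 1 else 0)"
    by (intro allI regular_solve[OF regular])
  from choice[OF this] obtain y
    where y: "\<forall>d. \<forall>b<p. (\<Sum>c<p. coeff (E b c) m * y d c) = (if b = d then 1 else 0)"
    by blast
  define Z where "Z t b d = - (\<Sum>c<p. coeff (E b c) t * y d c)" for t b d
  have Z: "\<sigma> a d (i + m) = (\<Sum>t<m. \<Sum>b<p. \<sigma> a b (i + t) * Z t b d)" if "a < p" "d < p" for i a d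
  proof -
    have "0 = (\<Sum>c<p. (\<Sum>b<p. pact (E b c) (\<sigma> a b) i) * y d c)"
      using kernel that(1) by simp
    also have "\<dots> = (\<Sum>c<p. \<Sum>b<p. \<Sum>t\<le>m. \<sigma> a b (i + t) * (coeff (E b c) t * y d c))"
      by (simp add: pact_bound[OF degree_E] sum_distrib_right sum_distrib_left mult_ac add.commute)
    also have "\<dots> = (\<Sum>b<p. \<Sum>c<p. \<Sum>t\<le>m. \<sigma> a b (i + t) * (coeff (E b c) t * y d c))"
      by (rule sum.swap)
    also have "\<dots> = (\<Sum>b<p. \<Sum>t\<le>m. \<Sum>c<p. \<sigma> a b (i + t) * (coeff (E b c) t * y d c))"
      by (intro sum.cong refl sum.swap)
    also have "\<dots> = (\<Sum>t\<le>m. \<Sum>b<p. \<sigma> a b (i + t) * (\<Sum>c<p. coeff (E b c) t * y d c))"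
      by (subst sum.swap) (simp only: sum_distrib_left)
    also have "\<dots> = (\<Sum>t<m. \<Sum>b<p. \<sigma> a b (i + t) * (\<Sum>c<p. coeff (E b c) t * y d c))
        + (\<Sum>b<p. \<sigma> a b (i + m) * (\<Sum>c<p. coeff (E b c) m * y d c))"
      by (simp flip: lessThan_Suc_atMost)
    also have "(\<Sum>b<p. \<sigma> a b (i + m) * (\<Sum>c<p. coeff (E b c) m * y d c)) = (\<Sum>b<p. if b = d then \<sigma> a b (i + m) else 0)"
      using y by (intro sum.cong refl) simp
    also have "\<dots> = \<sigma> a d (i + m)" using that by simp
    finally show ?thesis by (simp add: Z_def sum_negf eq_neg_iff_add_eq_0 add.commute)
  qed
  show ?case
  proof (cases "k < m")
    case True
    have "\<sigma> a b (i + k) = (\<Sum>t<m. \<Sum>c<p. \<sigma> a c (i + t) * (if t = k \<and> c = b then 1 else 0))"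
      if "a < p" "b < p" for i a b
    proof -
      have "(\<Sum>t<m. \<Sum>c<p. \<sigma> a c (i + t) * (if t = k \<and> c = b then 1 else 0)) =
          (\<Sum>t<m. if t = k then \<sigma> a b (i + t) else 0)"
        using that by (intro sum.cong refl) (simp add: if_distrib[of "(*) _"] cong: if_cong)
      also have "\<dots> = \<sigma> a b (i + k)" using True that by simp
      finally show ?thesis ..
    qed
    then show ?thesis by (intro exI[of _ "\<lambda>t c b. if t = k \<and> c = b then 1 else 0"]) simp
  next
    case False
    define r where "r = k - m"
    have k: "k = r + m" using False by (simp add: r_def)
    have "\<exists>X. t < m \<longrightarrow> (\<forall>i a b. a < p \<and> b < p \<longrightarrow>
        \<sigma> a b (i + (r + t)) = (\<Sum>u<m. \<Sum>c<p. \<sigma> a c (i + u) * X u c b))" for t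
    proof (cases "t < m")
      case True
      then show ?thesis using less.IH[of "r + t"] by (simp add: k)
    qed simp
    then have "\<forall>t. \<exists>X. t < m \<longrightarrow> (\<forall>i a b. a < p \<and> b < p \<longrightarrow>
        \<sigma> a b (i + (r + t)) = (\<Sum>u<m. \<Sum>c<p. \<sigma> a c (i + u) * X u c b))" ..
    from choice[OF this] obtain X where X: "\<forall>t. t < m \<longrightarrow> (\<forall>i a b. a < p \<and> b < p \<longrightarrow>
        \<sigma> a b (i + (r + t)) = (\<Sum>u<m. \<Sum>c<p. \<sigma> a c (i + u) * X t u c b))"
      by blast
    let ?X = "\<lambda>u c d. \<Sum>t<m. \<Sum>b<p. X t u c b * Z t b d"
    have "\<sigma> a d (i + k) = (\<Sum>u<m. \<Sum>c<p. \<sigma> a c (i + u) * ?X u c d)" if "a < p" "d < p" for i a d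
    proof -
      have "\<sigma> a d (i + k) = (\<Sum>t<m. \<Sum>b<p. \<sigma> a b (i + (r + t)) * Z t b d)"
        using Z[OF that, of "i + r"] by (simp add: k add.assoc)
      also have "\<dots> = (\<Sum>t<m. \<Sum>b<p. \<Sum>u<m. \<Sum>c<p. \<sigma> a c (i + u) * (X t u c b * Z t b d))"
        using that by (simp add: X sum_distrib_right mult.assoc)
      also have "\<dots> = (\<Sum>t<m. \<Sum>u<m. \<Sum>b<p. \<Sum>c<p. \<sigma> a c (i + u) * (X t u c b * Z t b d))"
        by (intro sum.cong refl sum.swap)
      also have "\<dots> = (\<Sum>u<m. \<Sum>t<m. \<Sum>c<p. \<Sum>b<p. \<sigma> a c (i + u) * (X t u c b * Z t b d))"
        by (subst sum.swap) (intro sum.cong refl sum.swap)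
      also have "\<dots> = (\<Sum>u<m. \<Sum>c<p. \<Sum>t<m. \<Sum>b<p. \<sigma> a c (i + u) * (X t u c b * Z t b d))"
        by (intro sum.cong refl sum.swap)
      finally show ?thesis by (simp only: sum_distrib_left)
    qed
    then show ?thesis by (intro exI[of _ ?X]) simp
  qed
qed

lemma form_lowdeg:
  assumes f: "lowdeg N f" and g: "lowdeg N g"
  shows "form f (\<lambda>a. monom 1 t * g a) = (\<Sum>i<N. \<Sum>a<p. \<Sum>j<N. \<Sum>b<p.
     cnj (coeff (f a) i) * \<sigma> a b (t + i + j) * coeff (g b) j)"
proof -
  have "pact (map_poly cnj (f a) * (monom 1 t * g b)) (\<sigma> a b) 0 =
      (\<Sum>i<N. \<Sum>j<N. cnj (coeff (f a) i) * \<sigma> a b (t + i + j) * coeff (g b) j)" for a b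
  proof -
    have "pact (monom 1 t * g b) (\<sigma> a b) i = (\<Sum>j<N. coeff (g b) j * \<sigma> a b (t + i + j))" for i
    proof -
      have "pact (monom 1 t * g b) (\<sigma> a b) i = pact (g b) (\<sigma> a b) (i + t)"
        by (simp add: pact_mult pact_monom)
      also have "\<dots> = (\<Sum>j<N. coeff (g b) j * \<sigma> a b (j + (i + t)))"
        by (rule pact_lowdeg) (use g in \<open>simp add: lowdeg_def\<close>)
      finally show ?thesis by (simp add: add_ac)
    qed
    then have seq: "pact (monom 1 t * g b) (\<sigma> a b) = (\<lambda>i. \<Sum>j<N. coeff (g b) j * \<sigma> a b (t + i + j))" ..
    have "pact (map_poly cnj (f a)) x 0 = (\<Sum>i<N. cnj (coeff (f a) i) * x i)" for x
      using pact_lowdeg[of N "map_poly cnj (f a)" x 0] f by (simp add: lowdeg_def)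
    then show ?thesis
      unfolding pact_mult[of "map_poly cnj (f a)"] seq by (simp add: sum_distrib_left mult_ac)
  qed
  then have "form f (\<lambda>a. monom 1 t * g a) = (\<Sum>a<p. \<Sum>b<p. \<Sum>i<N. \<Sum>j<N.
     cnj (coeff (f a) i) * \<sigma> a b (t + i + j) * coeff (g b) j)"
    by (simp add: form_def)
  also have "\<dots> = (\<Sum>a<p. \<Sum>i<N. \<Sum>b<p. \<Sum>j<N.
     cnj (coeff (f a) i) * \<sigma> a b (t + i + j) * coeff (g b) j)"
    by (intro sum.cong refl sum.swap)
  also have "\<dots> = (\<Sum>i<N. \<Sum>a<p. \<Sum>j<N. \<Sum>b<p.
     cnj (coeff (f a) i) * \<sigma> a b (t + i + j) * coeff (g b) j)"
    by (subst sum.swap) (intro sum.cong refl sum.swap)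
  finally show ?thesis .
qed

text \<open>Attaching (-1)^i to the i-th block of the vector absorbs the alternation of
  \<open>\<sigma>\<close>: of the signs (-1)^i, (-1)^(t+i+j) and (-1)^j only (-1)^t
  survives.\<close>

lemma hankel_pos_iff:
  assumes s: "\<And>a b k. a < p \<Longrightarrow> b < p \<Longrightarrow> s k $$ (a, b) = (- 1) ^ k * \<sigma> a b k" and p: "1 \<le> p"
  shows "hankel_pos t \<longleftrightarrow>
    pos_def_on (m * p) (\<lambda>r c. s (t + r div p + c div p) $$ (r mod p, c mod p))"
    (is "_ \<longleftrightarrow> pos_def_on _ ?H")
proof -
  have val: "sesq (m * p) ?H v v = (- 1) ^ t * form f (\<lambda>a. monom 1 t * f a)"
    if f: "lowdeg m f" and v: "\<And>i a. i < m \<Longrightarrow> a < p \<Longrightarrow> v (i * p + a) = (- 1) ^ i * coeff (f a) i" for v f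
  proof -
    have "sesq (m * p) ?H v v = (\<Sum>i<m. \<Sum>a<p. \<Sum>j<m. \<Sum>b<p.
        cnj (v (i * p + a)) * s (t + i + j) $$ (a, b) * v (j * p + b))"
      unfolding sesq_def sum_lessThan_mult by (intro sum.cong refl) (use p in simp)
    also have "\<dots> = (\<Sum>i<m. \<Sum>a<p. \<Sum>j<m. \<Sum>b<p.
        (- 1) ^ t * (cnj (coeff (f a) i) * \<sigma> a b (t + i + j) * coeff (f b) j))"
    proof (intro sum.cong refl)
      fix i a j b assume "i \<in> {..<m}" "a \<in> {..<p}" "j \<in> {..<m}" "b \<in> {..<p}"
      moreover have "(- 1) ^ i * (- 1) ^ (t + i + j) * (- 1) ^ j = (- 1 :: complex) ^ t"
        by (simp add: power_add)
      ultimately show "cnj (v (i * p + a)) * s (t + i + j) $$ (a, b) * v (j * p + b) =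
          (- 1) ^ t * (cnj (coeff (f a) i) * \<sigma> a b (t + i + j) * coeff (f b) j)"
        by (simp add: v s mult_ac)
    qed
    finally show ?thesis by (simp add: form_lowdeg[OF f f] sum_distrib_left)
  qed
  show ?thesis
  proof
    assume pos: "hankel_pos t"
    show "pos_def_on (m * p) ?H"
      unfolding pos_def_on_def
    proof (intro allI impI)
      fix v :: "nat \<Rightarrow> complex" assume "\<exists>r<m * p. v r \<noteq> 0"
      then obtain r where r: "r < m * p" "v r \<noteq> 0" by blast
      define f where "f a = (\<Sum>i<m. monom ((- 1) ^ i * v (i * p + a)) i)" for a
      have cf: "coeff (f a) i = (if i < m then (- 1) ^ i * v (i * p + a) else 0)" for a i
        by (simp add: f_def coeff_sum)
      then have f: "lowdeg m f" by (simp add: lowdeg_def)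
      have "v (i * p + a) = (- 1) ^ i * coeff (f a) i" if "i < m" for i a
        using that by (simp add: cf flip: power_add mult.assoc)
      then have val: "sesq (m * p) ?H v v = (- 1) ^ t * form f (\<lambda>a. monom 1 t * f a)"
        by (intro val f)
      have "r div p < m" using r(1) by (simp add: less_mult_imp_div_less)
      then have "coeff (f (r mod p)) (r div p) \<noteq> 0"
        using r(2) by (simp add: cf)
      then have "f (r mod p) \<noteq> 0" by auto
      then have "\<exists>a<p. f a \<noteq> 0" using p by (intro exI[of _ "r mod p"]) simp
      then show "0 < Re (sesq (m * p) ?H v v)"
        unfolding val using pos f unfolding hankel_pos_def by blast
    qed
  next
    assume pos: "pos_def_on (m * p) ?H"
    show "hankel_pos t"
      unfolding hankel_pos_def
    proof (intro allI impI, elim conjE exE)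
      fix f a assume f: "lowdeg m f" and a: "a < p" "f a \<noteq> 0"
      define v where "v r = (- 1) ^ (r div p) * coeff (f (r mod p)) (r div p)" for r
      have v: "v (i * p + a) = (- 1) ^ i * coeff (f a) i" if "a < p" for i a
        using that by (simp add: v_def)
      obtain i where i: "coeff (f a) i \<noteq> 0" using a(2) by (auto simp: poly_eq_iff)
      then have "i < m" using f unfolding lowdeg_def by (meson not_le)
      then have "i * p + a < m * p"
        using a(1) mult_le_mono1[of "Suc i" m p] by simp
      moreover have "v (i * p + a) \<noteq> 0" using i v[OF a(1)] by simp
      ultimately have "0 < Re (sesq (m * p) ?H v v)" by (rule pos_def_onD[OF pos])
      also have "sesq (m * p) ?H v v = (- 1) ^ t * form f (\<lambda>a. monom 1 t * f a)"
        by (intro val f v)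
      finally show "0 < Re ((- 1) ^ t * form f (\<lambda>a. monom 1 t * f a))" .
    qed
  qed
qed

end

section \<open>Even and odd parts, matrix fractions\<close>

lemma sum_even_odd:
  fixes f :: "nat \<Rightarrow> 'a :: comm_monoid_add"
  shows "(\<Sum>k\<le>2 * m. f k) = (\<Sum>k\<le>m. f (2 * k)) + (\<Sum>k\<in>{1..m}. f (2 * k - 1))"
    and "(\<Sum>k\<le>2 * m + 1. f k) = (\<Sum>k\<le>m. f (2 * k)) + (\<Sum>k\<le>m. f (2 * k + 1))"
proof -
  show "(\<Sum>k\<le>2 * m. f k) = (\<Sum>k\<le>m. f (2 * k)) + (\<Sum>k\<in>{1..m}. f (2 * k - 1))"
    by (induction m) (simp_all add: ac_simps)
  show "(\<Sum>k\<le>2 * m + 1. f k) = (\<Sum>k\<le>m. f (2 * k)) + (\<Sum>k\<le>m. f (2 * k + 1))"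
    by (induction m) (simp_all add: ac_simps)
qed

lemma pcompose_monom_square:
  "pcompose (monom c i) [:0, 0, 1:] = (monom c (2 * i) :: 'a :: comm_ring_1 poly)"
  by (induction i) (simp_all add: monom_0 monom_Suc pcompose_pCons)

lemma matrix_fraction_eq:
  assumes E: "E \<in> carrier_mat p p" and N: "N \<in> carrier_mat p p" and det: "det E \<noteq> 0"
    and ac: "a < p" "c < p"
  shows "(\<Sum>b<p. (N * minv E) $$ (a, b) * E $$ (b, c)) = N $$ (a, c)"
proof -
  have M: "minv E \<in> carrier_mat p p" using adj_mat(1)[OF E] by (simp add: minv_def)
  have ME: "minv E * E = 1\<^sub>m p"
    unfolding minv_def using det adj_mat(1,3)[OF E] E
    by (subst mult_smult_assoc_mat[of _ p p _ p]) (auto intro!: eq_matI)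
  define X where "X = N * minv E"
  have X: "X \<in> carrier_mat p p" using N M by (simp add: X_def)
  have "X * E = N * (minv E * E)" unfolding X_def by (rule assoc_mult_mat[OF N M E])
  also have "\<dots> = N" unfolding ME using N by simp
  finally have "X * E = N" .
  moreover have "(X * E) $$ (a, c) = (\<Sum>b<p. X $$ (a, b) * E $$ (b, c))"
    using X E ac by (auto simp: scalar_prod_def atLeast0LessThan intro!: sum.cong)
  ultimately show ?thesis by (simp add: X_def)
qed

lemma hermitian_matD:
  assumes "hermitian_mat M" "M \<in> carrier_mat p p" "i < p" "j < p"
  shows "M $$ (i, j) = cnj (M $$ (j, i))"
  using assms(1)[unfolded hermitian_mat_def, THEN conjunct2, rule_format, of i j] assms(2-4) by simp

theorem theorem4p15:
  fixes p n m :: nat and A :: "nat \<Rightarrow> complex mat"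
    and s :: "nat \<Rightarrow> complex mat" and sm1 :: "complex mat"
  assumes p_pos: "p \<ge> 1"
    and deg: "n = 2 * m \<or> n = 2 * m + 1"
    and coeffs: "\<forall>k\<le>n. A k \<in> carrier_mat p p"
    and monic: "A 0 = 1\<^sub>m p"
    and markov: "markov_params p n A (if even n then 0\<^sub>m p p else sm1) s"
    and herm: "\<forall>k. hermitian_mat (s k)"
    and herm_m1: "odd n \<longrightarrow> hermitian_mat sm1"
  shows "hurwitz_mpoly p n A \<longleftrightarrow>
     (\<forall>l j0 k0. 1 \<le> l \<and> l \<le> m \<longrightarrow>
        (let M = block_hankel p s l (\<lambda>a. j0 + a) (\<lambda>b. k0 + b)
         in det (bh_lead p l M) \<noteq> 0 \<and> pos_def_mat (quasiminor p l M)))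
   \<and> (\<forall>l js ks. m < l \<and> strict_inc_upto l js \<and> strict_inc_upto l ks \<longrightarrow>
        det (block_hankel p s l js ks) = 0)
   \<and> (odd n \<longrightarrow> pos_def_mat sm1)"
proof -
  define E where "E a b = (\<Sum>k\<le>m. monom (A (if even n then 2 * k else 2 * k + 1) $$ (a, b)) (m - k))" for a b
  define D where "D a b = (if even n then \<Sum>k\<in>{1..m}. monom (A (2 * k - 1) $$ (a, b)) (m - k)
    else \<Sum>k\<le>m. monom (A (2 * k) $$ (a, b)) (m - k))" for a b
  define \<sigma> where "\<sigma> a b k = (- 1) ^ k * s k $$ (a, b)" for a b k
  define C where "C a b = (if even n then 0 else sm1 $$ (a, b))" for a b
  define G where "G a b = (\<Sum>k\<le>n. monom (A k $$ (a, b)) (n - k))" for a b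
  define c where "c = (if even n then 0\<^sub>m p p else sm1)"
  have n2: "n div 2 = m" using deg by auto
  have s_carrier: "s k \<in> carrier_mat p p" for k
    using markov by (simp add: markov_params_def)
  have c_carrier: "c \<in> carrier_mat p p"
    using markov by (simp add: markov_params_def c_def)
  have s_herm: "s k $$ (a, b) = cnj (s k $$ (b, a))" if "a < p" "b < p" for k a b
    using herm s_carrier that by (intro hermitian_matD[of "s k" p]) simp_all
  have s_\<sigma>: "s k $$ (a, b) = (- 1) ^ k * \<sigma> a b k" for k a b
    by (simp add: \<sigma>_def flip: mult.assoc power_add)
  have C_c: "C a b = c $$ (a, b)" if "a < p" "b < p" for a b
    using that by (simp add: C_def c_def)
  have degree_E: "degree (E a b) \<le> m" for a b
    unfolding E_def by (intro degree_sum_le) (auto intro: order.trans[OF degree_monom_le])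
  have even_part: "even_part p n A z = mat p p (\<lambda>(a, b). poly (E a b) z)" for z
    unfolding even_part_def E_def Let_def n2
    by (rule eq_matI) (auto simp: poly_sum poly_monom)
  have odd_part: "odd_part p n A z = mat p p (\<lambda>(a, b). poly (D a b) z)" for z
    unfolding odd_part_def D_def Let_def n2
    by (rule eq_matI) (auto simp: poly_sum poly_monom)
  have G_eq: "G a b = pcompose (E a b) [:0, 0, 1:] + pCons 0 (pcompose (D a b) [:0, 0, 1:])" for a b
  proof -
    have pC: "(\<Sum>k\<in>K. pCons 0 (f k)) = pCons 0 (\<Sum>k\<in>K. f k)" for K and f :: "nat \<Rightarrow> complex poly"
      by (induction K rule: infinite_finite_induct) auto
    from deg show ?thesis
    proof
      assume n: "n = 2 * m"
      have "(\<Sum>k\<le>m. monom (A (2 * k) $$ (a, b)) (2 * m - 2 * k)) =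
          (\<Sum>k\<le>m. monom (A (2 * k) $$ (a, b)) (2 * (m - k)))"
        by (intro sum.cong refl) (simp add: diff_mult_distrib2)
      moreover have "(\<Sum>k\<in>{1..m}. monom (A (2 * k - 1) $$ (a, b)) (2 * m - (2 * k - 1))) =
          (\<Sum>k\<in>{1..m}. pCons 0 (monom (A (2 * k - 1) $$ (a, b)) (2 * (m - k))))"
      proof (intro sum.cong refl)
        fix k assume "k \<in> {1..m}"
        then have "2 * m - (2 * k - 1) = Suc (2 * (m - k))" by auto
        then show "monom (A (2 * k - 1) $$ (a, b)) (2 * m - (2 * k - 1)) =
            pCons 0 (monom (A (2 * k - 1) $$ (a, b)) (2 * (m - k)))"
          by (simp only: monom_Suc)
      qed
      ultimately show ?thesis
        unfolding G_def E_def D_def n sum_even_odd(1)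
        by (simp add: pcompose_sum pC pcompose_monom_square)
    next
      assume n: "n = 2 * m + 1"
      have "(\<Sum>k\<le>m. monom (A (2 * k) $$ (a, b)) (2 * m + 1 - 2 * k)) =
          (\<Sum>k\<le>m. pCons 0 (monom (A (2 * k) $$ (a, b)) (2 * (m - k))))"
      proof (intro sum.cong refl)
        fix k assume "k \<in> {..m}"
        then have "2 * m + 1 - 2 * k = Suc (2 * (m - k))" by auto
        then show "monom (A (2 * k) $$ (a, b)) (2 * m + 1 - 2 * k) =
            pCons 0 (monom (A (2 * k) $$ (a, b)) (2 * (m - k)))"
          by (simp only: monom_Suc)
      qed
      moreover have "(\<Sum>k\<le>m. monom (A (2 * k + 1) $$ (a, b)) (2 * m + 1 - (2 * k + 1))) =
          (\<Sum>k\<le>m. monom (A (2 * k + 1) $$ (a, b)) (2 * (m - k)))"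
        by (intro sum.cong refl) (simp add: diff_mult_distrib2)
      ultimately show ?thesis
        unfolding G_def E_def D_def n sum_even_odd(2)
        by (simp add: pcompose_sum pC pcompose_monom_square)
    qed
  qed
  \<comment> \<open>Clearing the denominator in the Markov expansion equates a series in negative
    powers of z with a polynomial, so both vanish. The series gives \<open>kernel\<close>; the
    polynomial identifies \<open>Od\<close> with the given odd part.\<close>
  have tail: "pact_sum = 0 \<and> q = 0"
    if "a < p" "d < p" and ps: "pact_sum = (\<Sum>b<p. pact (E b d) (\<sigma> a b) k)"
      and q: "q = D a d - (\<Sum>b<p. smult (C a b) (E b d)) - (\<Sum>b<p. dquot (E b d) (\<sigma> a b))"
    for a d k pact_sum q
  proof -
    obtain R where R: "\<And>z. R < norm z \<Longrightarrow> det (even_part p n A z) \<noteq> 0"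
      "\<And>z i j. R < norm z \<Longrightarrow> i < p \<Longrightarrow> j < p \<Longrightarrow>
        (\<lambda>k. (- 1) ^ k / z ^ (k + 1) * s k $$ (i, j)) sums
          ((odd_part p n A z * minv (even_part p n A z)) $$ (i, j) - c $$ (i, j))"
      using markov unfolding markov_params_def c_def by blast
    \<comment> \<open>The bound is |R| rather than R because R may be negative and z must be
      nonzero.\<close>
    have sums: "(\<lambda>k. (\<Sum>b<p. pact (E b d) (\<sigma> a b) k) / z ^ (k + 1)) sums poly q z" if z: "\<bar>R\<bar> < norm z" for z
    proof -
      let ?g = "\<lambda>b. (odd_part p n A z * minv (even_part p n A z)) $$ (a, b) - c $$ (a, b)"
      have "z \<noteq> 0" using z by auto
      have "(\<lambda>k. \<Sum>b<p. pact (E b d) (\<sigma> a b) k / z ^ (k + 1)) sums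
          (\<Sum>b<p. ?g b * poly (E b d) z - poly (dquot (E b d) (\<sigma> a b)) z)"
      proof (rule sums_sum)
        fix b assume "b \<in> {..<p}"
        then have "(\<lambda>k. \<sigma> a b k / z ^ (k + 1)) sums ?g b"
          using R(2)[of z a b] z \<open>a < p\<close> by (simp add: \<sigma>_def)
        then show "(\<lambda>k. pact (E b d) (\<sigma> a b) k / z ^ (k + 1)) sums
            (?g b * poly (E b d) z - poly (dquot (E b d) (\<sigma> a b)) z)"
          using \<open>z \<noteq> 0\<close> by (rule sums_pact)
      qed
      moreover have "(\<Sum>b<p. (odd_part p n A z * minv (even_part p n A z)) $$ (a, b) * poly (E b d) z) = poly (D a d) z"
        using matrix_fraction_eq[of "even_part p n A z" p "odd_part p n A z" a d] R(1)[of z] z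
          \<open>a < p\<close> \<open>d < p\<close> by (simp add: even_part odd_part)
      ultimately show ?thesis
        using \<open>a < p\<close> by (simp add: q sum_divide_distrib poly_sum left_diff_distrib sum_subtractf C_c)
    qed
    show ?thesis using laurent_tail_eq_poly[OF sums] ps by simp
  qed
  have kernel: "(\<Sum>b<p. pact (E b d) (\<sigma> a b) k) = 0" if "a < p" "d < p" for a d k
    using tail[OF that refl refl] by blast
  interpret hankel_system p m E \<sigma> C
  proof
    show "degree (E a b) \<le> m" for a b by (rule degree_E)
    show "(\<Sum>b<p. pact (E b d) (\<sigma> a b) k) = 0" if "a < p" "d < p" for a d k by (rule kernel[OF that])
    show "cnj (\<sigma> a b k) = \<sigma> b a k" if "a < p" "b < p" for a b k
      using s_herm[OF that(2,1), of k] by (simp add: \<sigma>_def)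
    show "cnj (C a b) = C b a" if "a < p" "b < p" for a b
    proof (cases "even n")
      case False
      then have "hermitian_mat sm1" "sm1 \<in> carrier_mat p p" using herm_m1 c_carrier by (auto simp: c_def)
      then have "sm1 $$ (b, a) = cnj (sm1 $$ (a, b))" using that by (intro hermitian_matD)
      then show ?thesis by (simp add: C_def)
    qed (simp add: C_def)
  qed
  have Od_eq: "Od a d = D a d" if "a < p" "d < p" for a d
    using tail[OF that refl refl, of 0] by (simp add: Od_def algebra_simps)
  then have F_eq: "F a d = G a d" if "a < p" "d < p" for a d
    using that by (simp add: F_def G_eq)
  have coeff_G: "coeff (G a b) n = A 0 $$ (a, b)" for a b
  proof -
    have "coeff (G a b) n = (\<Sum>k\<le>n. if k = 0 then A k $$ (a, b) else 0)"
      unfolding G_def coeff_sum by (intro sum.cong refl) auto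
    then show ?thesis by simp
  qed
  have one: "det (mat p p (\<lambda>(a, d). A 0 $$ (a, d))) \<noteq> 0"
  proof -
    have "mat p p (\<lambda>(a, d). A 0 $$ (a, d)) = 1\<^sub>m p" by (rule eq_matI) (auto simp: monic)
    then show ?thesis by simp
  qed
  have regular_E: "det (mat p p (\<lambda>(a, d). coeff (E a d) m)) \<noteq> 0"
  proof (cases "even n")
    case True
    have "coeff (E a b) m = A 0 $$ (a, b)" for a b
    proof -
      have "coeff (E a b) m = (\<Sum>k\<le>m. if k = 0 then A 0 $$ (a, b) else 0)"
        unfolding E_def coeff_sum using True by (intro sum.cong refl) auto
      then show ?thesis by simp
    qed
    then show ?thesis using one by simp
  next
    case False
    \<comment> \<open>In odd degree the leading coefficient of E is A_1. Comparing coefficients of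
      degree m in Od = D, where \<open>dquot\<close> has lower degree, gives s_{-1} A_1 = A_0 =
      I.\<close>
    have CE: "(\<Sum>b<p. C a b * coeff (E b d) m) = (if a = d then 1 else 0)" if "a < p" "d < p" for a d
    proof -
      have "coeff (D a d) m = (\<Sum>k\<le>m. if k = 0 then A 0 $$ (a, d) else 0)"
      proof -
        have "coeff (D a d) m = (\<Sum>k\<le>m. coeff (monom (A (2 * k) $$ (a, d)) (m - k)) m)"
          using False by (simp add: D_def coeff_sum)
        also have "\<dots> = (\<Sum>k\<le>m. if k = 0 then A 0 $$ (a, d) else 0)"
          by (intro sum.cong refl) auto
        finally show ?thesis .
      qed
      moreover have "coeff (dquot (E b d) (\<sigma> a b)) m = 0" for b
        by (rule coeff_dquot_eq_0[OF degree_E])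
      ultimately show ?thesis
        using arg_cong[OF Od_eq[OF that], of "\<lambda>f. coeff f m"] that by (simp add: Od_def coeff_sum monic)
    qed
    show ?thesis
      unfolding singular_null_vector
    proof (intro notI, elim exE conjE)
      fix v d assume v: "\<forall>b<p. (\<Sum>d<p. coeff (E b d) m * v d) = 0" and d: "d < p" "v d \<noteq> 0"
      have "v d = (\<Sum>e<p. (\<Sum>b<p. C d b * coeff (E b e) m) * v e)"
        using CE[OF d(1)] d(1) by (simp add: if_distrib[of "\<lambda>x. x * _"] cong: if_cong)
      also have "\<dots> = (\<Sum>b<p. C d b * (\<Sum>e<p. coeff (E b e) m * v e))"
        by (simp only: sum_distrib_left sum_distrib_right mult.assoc) (rule sum.swap)
      also have "\<dots> = 0" using v by simp
      finally show False using d(2) by simp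
    qed
  qed
  interpret regular_hankel_system p m E \<sigma> C n
  proof
    show "det (mat p p (\<lambda>(a, d). coeff (E a d) m)) \<noteq> 0" by (rule regular_E)
    have "mat p p (\<lambda>(a, d). coeff (F a d) n) = mat p p (\<lambda>(a, d). A 0 $$ (a, d))"
      by (rule eq_matI) (auto simp: F_eq coeff_G)
    then show "det (mat p p (\<lambda>(a, d). coeff (F a d) n)) \<noteq> 0" using one by simp
    show "degree (F a d) \<le> n" if "a < p" "d < p" for a d
      unfolding F_eq[OF that] G_def by (intro degree_sum_le) (auto intro: order.trans[OF degree_monom_le])
    show "n = 2 * m \<or> n = 2 * m + 1" by (rule deg)
    show "C a b = 0" if "n = 2 * m" for a b using that by (simp add: C_def)
  qed
  have hurwitz: "hurwitz_mpoly p n A \<longleftrightarrow> hurwitz"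
  proof -
    have "mpoly_eval p n A z = mat p p (\<lambda>(a, d). poly (F a d) z)" for z
      unfolding mpoly_eval_def by (rule eq_matI) (auto simp: F_eq G_def poly_sum poly_monom mult.commute)
    then show ?thesis by (simp add: hurwitz_mpoly_def hurwitz_def)
  qed
  have odd_iff: "n = 2 * m + 1 \<longleftrightarrow> odd n" using deg by auto
  have C_pos: "pos_def_mat sm1 \<longleftrightarrow>
      (\<forall>v. (\<exists>b<p. v b \<noteq> 0) \<longrightarrow> 0 < Re (\<Sum>a<p. \<Sum>b<p. cnj (v a) * C a b * v b))" if "odd n"
  proof -
    have "hermitian_mat sm1" "sm1 \<in> carrier_mat p p" using herm_m1 c_carrier that by (auto simp: c_def)
    then have "pos_def_mat sm1 \<longleftrightarrow> pos_def_on p (\<lambda>i j. sm1 $$ (i, j))"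
      using pos_def_mat_iff[of sm1 p] hermitian_matD[of sm1 p] by blast
    then show ?thesis using that by (simp add: pos_def_on_def sesq_def C_def)
  qed
  have minors: "det (block_hankel p s l js ks) = 0" if "m < l" for l js ks
  proof -
    have "\<forall>k. \<exists>X. \<forall>i a b. a < p \<and> b < p \<longrightarrow> \<sigma> a b (i + k) = (\<Sum>t<m. \<Sum>d<p. \<sigma> a d (i + t) * X t d b)"
      by (intro allI recurrence regular_E)
    from choice[OF this] obtain X where X: "\<forall>k i a b. a < p \<and> b < p \<longrightarrow>
        \<sigma> a b (i + k) = (\<Sum>t<m. \<Sum>d<p. \<sigma> a d (i + t) * X k t d b)"
      by blast
    show ?thesis
    proof (rule block_hankel_det_eq_0[OF _ that p_pos])
      fix k i a b assume "a < p" "b < p"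
      then have "s (i + k) $$ (a, b) = (- 1) ^ (i + k) * (\<Sum>t<m. \<Sum>d<p. \<sigma> a d (i + t) * X k t d b)"
        using X by (simp add: s_\<sigma>)
      \<comment> \<open>Passing from \<open>\<sigma>\<close> back to s changes the recurrence
        coefficients by (-1)^(k+t), still independent of the row i.\<close>
      also have "\<dots> = (\<Sum>t<m. \<Sum>d<p. s (i + t) $$ (a, d) * ((- 1) ^ (k + t) * X k t d b))"
        unfolding sum_distrib_left
      proof (intro sum.cong refl)
        fix t d
        have "(- 1) ^ (i + t) * (- 1) ^ (k + t) = (- 1 :: complex) ^ (i + k)"
          by (simp add: power_add)
        then show "(- 1) ^ (i + k) * (\<sigma> a d (i + t) * X k t d b) =
            s (i + t) $$ (a, d) * ((- 1) ^ (k + t) * X k t d b)"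
          by (simp add: s_\<sigma> mult_ac)
      qed
      finally show "s (i + k) $$ (a, b) = (\<Sum>t<m. \<Sum>d<p. s (i + t) $$ (a, d) * ((- 1) ^ (k + t) * X k t d b))" .
    qed
  qed
  let ?H = "\<lambda>t r c. s (t + r div p + c div p) $$ (r mod p, c mod p)"
  let ?Q = "\<lambda>l M. det (bh_lead p l M) \<noteq> 0 \<and> pos_def_mat (quasiminor p l M)"
  \<comment> \<open>A contiguous block depends on its starting indices only through t = j0 + k0, so
    the quasiminor condition is positivity of the m-block Hankel matrix for every shift t.\<close>
  have hankel: "block_hankel p s l (\<lambda>a. j0 + a) (\<lambda>b. k0 + b) = mat (l * p) (l * p) (\<lambda>(r, c). ?H (j0 + k0) r c)"
    for l j0 k0
    by (simp add: block_hankel_def add_ac)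
  have pos: "hankel_pos t \<longleftrightarrow> (\<forall>l. 1 \<le> l \<and> l \<le> m \<longrightarrow> ?Q l (mat (l * p) (l * p) (\<lambda>(r, c). ?H t r c)))" for t
  proof -
    have sym: "?H t r c = cnj (?H t c r)" for r c
      using s_herm[of "r mod p" "c mod p"] p_pos by (simp add: add_ac)
    have "hankel_pos t \<longleftrightarrow> pos_def_on (m * p) (?H t)"
      by (rule hankel_pos_iff[OF s_\<sigma> p_pos])
    also have "\<dots> \<longleftrightarrow> (\<forall>l. 1 \<le> l \<and> l \<le> m \<longrightarrow> ?Q l (mat (l * p) (l * p) (\<lambda>(r, c). ?H t r c)))"
      by (rule pos_def_on_quasiminors[OF sym refl])
    finally show ?thesis .
  qed
  have "(\<forall>t. hankel_pos t) \<longleftrightarrow> (\<forall>l j0 k0. 1 \<le> l \<and> l \<le> m \<longrightarrow>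
      ?Q l (block_hankel p s l (\<lambda>a. j0 + a) (\<lambda>b. k0 + b)))"
    (is "?P \<longleftrightarrow> ?R")
  proof
    assume ?P
    then show ?R unfolding hankel pos by (intro allI) (drule spec, erule spec)
  next
    assume R: ?R
    show ?P unfolding pos
    proof
      fix t
      show "\<forall>l. 1 \<le> l \<and> l \<le> m \<longrightarrow> ?Q l (mat (l * p) (l * p) (\<lambda>(r, c). ?H t r c))"
        \<comment> \<open>Every shift t occurs, for instance with j0 = t and k0 = 0.\<close>
        using R[unfolded hankel, rule_format, of _ t 0] by simp
    qed
  qed
  then show ?thesis
    unfolding hurwitz hurwitz_iff Let_def odd_iff using C_pos minors by blast
qed

end
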